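(* Let $0<\varepsilon\le 1$ and let $|\psi\rangle^{ABR}\in\mathcal H_A\otimes\mathcal H_B\otimes\mathcal H_R$ be a tripartite pure state. Then the quantum communication cost $q^{(1)}_\varepsilon$ and the entanglement gain $e^{(1)}_\varepsilon$ of any $\varepsilon$-error one-shot FQSW protocol for $\psi^{ABR}$ satisfy $$q^{(1)}_{\varepsilon}\ \ge\ \tfrac12\left[H_{\min}^{\varepsilon}(A)_\psi-H_{\min}^{\overline{\varepsilon}}(A|R)_\psi\right]-\log\frac{\sqrt2}{\varepsilon},$$ $$e^{(1)}_\varepsilon\ \le\ q^{(1)}_\varepsilon+H_{\min}^{\overline{\varepsilon}}(A|R)_\psi+\log\frac{2}{\varepsilon^2},$$ where $\overline{\varepsilon}:=3\left(\varepsilon+\sqrt{3\sqrt{\varepsilon}}\right)$.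
   Context: All Hilbert spaces are finite-dimensional; $|A|=\dim\mathcal H_A$; logarithms are to base 2. $\mathcal D(\mathcal H)$ is the set of states (positive operators of trace 1) and $\mathcal D_\le(\mathcal H)$ the set of subnormalized states (positive operators of trace $\le 1$). For a pure state $|\psi\rangle$, write $\psi=|\psi\rangle\langle\psi|$; superscript subsystems denote reduced (partial-trace) states. One-shot FQSW protocol. Alice holds $A$, Bob holds $B$, and $R$ is an inaccessible reference. A protocol for $\psi^{ABR}$ consists of: an encoding CPTP map $\mathcal E^{A\to A_1A_2}$ performed by Alice, after which she sends the quantum system $A_2$ to Bob (renamed $B_2\simeq A_2$); then a decoding CPTP map $\mathcal D^{B_2B\to B_1B'B}$ performed by Bob, where $\mathcal H_{B_1}\simeq\mathcal H_{A_1}$ and $\mathcal H_{B'}\simeq\mathcal H_A$. Let $\widehat\Omega^{A_1B_1B'BR}$ be the final state. The protocol is $\varepsilon$-error if $\|\Phi^{A_1B_1}\otimes\psi^{B'BR}-\widehat\Omega^{A_1B_1B'BR}\|_1\le\varepsilon$, where $\Phi^{A_1B_1}$ is the maximally entangled state of Schmidt rank $|A_1|$, and $\psi^{B'BR}$ is the state $\psi^{ABR}$ with $A$ replaced by $B'$. Its quantum communication cost is $q^{(1)}_\varepsilon=\log|A_2|$ and its entanglement gain is $e^{(1)}_\varepsilon=\log|A_1|$. Entropies. Fidelity: $F(\rho,\sigma)=\|\sqrt\rho\sqrt\sigma\|_1$. $D_{\max}(\rho\|\sigma)=\log\min\{\lambda:\rho\le\lambda\sigma\}$. For $\rho^{AB}\in\mathcal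 D_\le(\mathcal H_A\otimes\mathcal H_B)$, $H_{\min}(A|B)_\rho=\max_{\sigma^B\in\mathcal D(\mathcal H_B)}[-D_{\max}(\rho^{AB}\|\mathbb I_A\otimes\sigma^B)]$; $H_{\min}(A)_\rho=-D_{\max}(\rho^A\|\mathbb I_A)$ is the case of trivial $B$. For $\rho\in\mathcal D(\mathcal H)$ and $\epsilon\ge 0$, $\mathcal B^\epsilon(\rho)=\{\overline\rho\in\mathcal D_\le(\mathcal H):F^2(\overline\rho,\rho)\ge1-\epsilon^2\}$, and $H_{\min}^\epsilon(A|B)_\rho=\max_{\overline\rho^{AB}\in\mathcal B^\epsilon(\rho^{AB})}H_{\min}(A|B)_{\overline\rho}$ (similarly for $H^\epsilon_{\min}(A)_\rho$). Convention: if $\overline\varepsilon\ge1$ then $H_{\min}^{\overline\varepsilon}(A|R)_\psi=+\infty$, and the two bounds are understood as vacuous (right-hand sides $-\infty$ and $+\infty$ respectively). *)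

theory Defs
  imports "HOL-Analysis.Analysis"
begin

(* A finite-dimensional Hilbert space is complex ^ 'n with its standard orthonormal basis indexed
   by 'n, and its dimension is CARD('n).  A tensor product has the product of the index types as
   its index type.  Operators are square matrices. *)

type_synonym 'n op = "complex ^ 'n ^ 'n"

definition dagger :: "'n::finite op \<Rightarrow> 'n op" where
  "dagger M = (\<chi> i j. cnj (M $ j $ i))"

definition cscale :: "complex \<Rightarrow> 'n::finite op \<Rightarrow> 'n op" where
  "cscale c M = (\<chi> i j. c * M $ i $ j)"

definition cdot :: "complex ^ 'n::finite \<Rightarrow> complex ^ 'n \<Rightarrow> complex" where
  "cdot v w = (\<Sum>i\<in>UNIV. cnj (v $ i) * w $ i)"

(* Over the complex numbers this includes self-adjointness. *)
definition psd :: "'n::finite op \<Rightarrow> bool" where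
  "psd M \<longleftrightarrow> (\<forall>v. cdot v (M *v v) \<in> \<real>\<^sub>\<ge>\<^sub>0)"

definition psd_sqrt :: "'n::finite op \<Rightarrow> 'n op" where
  "psd_sqrt M = (THE S. psd S \<and> S ** S = M)"

definition trace_norm :: "'n::finite op \<Rightarrow> real" where
  "trace_norm M = Re (trace (psd_sqrt (dagger M ** M)))"

definition ketbra :: "complex ^ 'n::finite \<Rightarrow> 'n op" where
  "ketbra v = (\<chi> i j. v $ i * cnj (v $ j))"

definition tensor :: "'m::finite op \<Rightarrow> 'n::finite op \<Rightarrow> ('m \<times> 'n) op" where
  "tensor M N = (\<chi> i j. M $ fst i $ fst j * N $ snd i $ snd j)"

definition ptrace_snd :: "('m::finite \<times> 'n::finite) op \<Rightarrow> 'm op" where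
  "ptrace_snd M = (\<chi> i j. \<Sum>k\<in>UNIV. M $ (i, k) $ (j, k))"

(* For a bijection f this is conjugation by the permutation unitary that relabels the basis; it is
   used to reorder and rebracket tensor factors. *)
definition reindex :: "('k \<Rightarrow> 'n) \<Rightarrow> 'n::finite op \<Rightarrow> 'k::finite op" where
  "reindex f M = (\<chi> i j. M $ f i $ f j)"

definition states :: "'n::finite op set" where
  "states = {\<rho>. psd \<rho> \<and> trace \<rho> = 1}"

definition substates :: "'n::finite op set" where
  "substates = {\<rho>. psd \<rho> \<and> Re (trace \<rho>) \<le> 1}"

definition complex_linear_map :: "('m::finite op \<Rightarrow> 'n::finite op) \<Rightarrow> bool" where
  "complex_linear_map T \<longleftrightarrow>
     (\<forall>X Y. T (X + Y) = T X + T Y) \<and> (\<forall>c X. T (cscale c X) = cscale c (T X))"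

(* Positivity of the n-by-n block operator with blocks X i j, acting on C^n tensor C^'m. *)
definition block_psd :: "nat \<Rightarrow> (nat \<Rightarrow> nat \<Rightarrow> 'm::finite op) \<Rightarrow> bool" where
  "block_psd n X \<longleftrightarrow>
     (\<forall>v :: nat \<Rightarrow> complex ^ 'm. (\<Sum>i<n. \<Sum>j<n. cdot (v i) (X i j *v v j)) \<in> \<real>\<^sub>\<ge>\<^sub>0)"

(* The identity on n-by-n matrices tensored with T is positive for every n.  The ancilla is
   indexed by {..<n}, because a definition cannot quantify over its index type. *)
definition completely_positive :: "('m::finite op \<Rightarrow> 'n::finite op) \<Rightarrow> bool" where
  "completely_positive T \<longleftrightarrow>
     (\<forall>n X. block_psd n X \<longrightarrow> block_psd n (\<lambda>i j. T (X i j)))"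

definition trace_preserving :: "('m::finite op \<Rightarrow> 'n::finite op) \<Rightarrow> bool" where
  "trace_preserving T \<longleftrightarrow> (\<forall>X. trace (T X) = trace X)"

definition cptp :: "('m::finite op \<Rightarrow> 'n::finite op) \<Rightarrow> bool" where
  "cptp T \<longleftrightarrow> complex_linear_map T \<and> completely_positive T \<and> trace_preserving T"

(* T tensor identity: T acts on every block of M labelled by a pair of basis elements of the second
   factor.  For linear T this sends tensor M N to tensor (T M) N. *)
definition on_fst ::
    "('m::finite op \<Rightarrow> 'n::finite op) \<Rightarrow> ('m \<times> 'k::finite) op \<Rightarrow> ('n \<times> 'k) op" where
  "on_fst T M = (\<chi> i j. T (\<chi> p q. M $ (p, snd i) $ (q, snd j)) $ fst i $ fst j)"

definition fidelity :: "'n::finite op \<Rightarrow> 'n op \<Rightarrow> real" where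
  "fidelity \<rho> \<sigma> = trace_norm (psd_sqrt \<rho> ** psd_sqrt \<sigma>)"

definition elog2 :: "real \<Rightarrow> ereal" where
  "elog2 x = (if x \<le> 0 then -\<infinity> else ereal (log 2 x))"

(* The infimum over an empty set is infinity, which covers the case that the support of \<rho> is not
   contained in that of \<sigma>.  For \<rho> = 0 and nonzero positive \<sigma> the least t is 0 and the value is
   minus infinity. *)
definition dmax :: "'n::finite op \<Rightarrow> 'n op \<Rightarrow> ereal" where
  "dmax \<rho> \<sigma> = (INF t\<in>{t::real. psd (t *\<^sub>R \<sigma> - \<rho>)}. elog2 t)"

definition hmin :: "'m::finite op \<Rightarrow> ereal" where
  "hmin \<rho> = - dmax \<rho> (mat 1)"

definition hmin_cond :: "('m::finite \<times> 'n::finite) op \<Rightarrow> ereal" where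
  "hmin_cond \<rho> = (SUP \<sigma>\<in>states. - dmax \<rho> (tensor (mat 1) \<sigma>))"

definition smoothing_ball :: "real \<Rightarrow> 'n::finite op \<Rightarrow> 'n op set" where
  "smoothing_ball \<epsilon> \<rho> = {\<rho>' \<in> substates. (fidelity \<rho>' \<rho>)\<^sup>2 \<ge> 1 - \<epsilon>\<^sup>2}"

definition hmin_smooth :: "real \<Rightarrow> 'm::finite op \<Rightarrow> ereal" where
  "hmin_smooth \<epsilon> \<rho> = (SUP \<rho>'\<in>smoothing_ball \<epsilon> \<rho>. hmin \<rho>')"

definition hmin_cond_smooth :: "real \<Rightarrow> ('m::finite \<times> 'n::finite) op \<Rightarrow> ereal" where
  "hmin_cond_smooth \<epsilon> \<rho> = (SUP \<rho>'\<in>smoothing_ball \<epsilon> \<rho>. hmin_cond \<rho>')"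

definition reduced_A :: "complex ^ ('a::finite \<times> 'b::finite \<times> 'r::finite) \<Rightarrow> 'a op" where
  "reduced_A \<psi> = ptrace_snd (ketbra \<psi>)"

definition reduced_AR :: "complex ^ ('a::finite \<times> 'b::finite \<times> 'r::finite) \<Rightarrow> ('a \<times> 'r) op" where
  "reduced_AR \<psi> = ptrace_snd (reindex (\<lambda>((a, r), b). (a, b, r)) (ketbra \<psi>))"

definition max_entangled :: "('k::finite \<times> 'k) op" where
  "max_entangled =
     ketbra (\<chi> i. if fst i = snd i then complex_of_real (1 / sqrt (real CARD('k))) else 0)"

(* In the types below 'a, 'b, 'r, 'a1, 'a2 index A, B, R, A1, A2.  The systems B1, B2, B' are
   isomorphic copies of A1, A2, A and reuse their index types.  The output of the decoder is
   ordered as B1 B' B, and the final state as (A1 B1) (B' B R). *)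
definition fqsw_final_state ::
    "complex ^ ('a::finite \<times> 'b::finite \<times> 'r::finite)
     \<Rightarrow> ('a op \<Rightarrow> ('a1::finite \<times> 'a2::finite) op)
     \<Rightarrow> (('a2 \<times> 'b) op \<Rightarrow> ('a1 \<times> 'a \<times> 'b) op)
     \<Rightarrow> (('a1 \<times> 'a1) \<times> ('a \<times> 'b \<times> 'r)) op" where
  "fqsw_final_state \<psi> enc dec =
     reindex (\<lambda>((a1, b1), (a, b, r)). ((b1, a, b), (a1, r)))
       (on_fst dec
         (reindex (\<lambda>((a2, b), (a1, r)). ((a1, a2), (b, r)))
           (on_fst enc (ketbra \<psi>))))"

definition fqsw_protocol ::
    "real \<Rightarrow> complex ^ ('a::finite \<times> 'b::finite \<times> 'r::finite)
     \<Rightarrow> ('a op \<Rightarrow> ('a1::finite \<times> 'a2::finite) op)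
     \<Rightarrow> (('a2 \<times> 'b) op \<Rightarrow> ('a1 \<times> 'a \<times> 'b) op)
     \<Rightarrow> bool" where
  "fqsw_protocol \<epsilon> \<psi> enc dec \<longleftrightarrow>
     cptp enc \<and> cptp dec \<and>
     trace_norm (tensor max_entangled (ketbra \<psi>) - fqsw_final_state \<psi> enc dec) \<le> \<epsilon>"

(* The two costs depend only on the type of the encoder. *)
definition communication_cost ::
    "('a::finite op \<Rightarrow> ('a1::finite \<times> 'a2::finite) op) \<Rightarrow> real" where
  "communication_cost enc = log 2 (real CARD('a2))"

definition entanglement_gain ::
    "('a::finite op \<Rightarrow> ('a1::finite \<times> 'a2::finite) op) \<Rightarrow> real" where
  "entanglement_gain enc = log 2 (real CARD('a1))"

end

(* Write the Stinespring isometries of encoder and decoder through Kraus operators E_k, D_l, let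
   L_kl be the Kraus operators of the whole protocol and phi = Phi (x) psi the target.  The numbers
   w_kl = <phi|L_kl psi> form a vector w of the two environments, and the error criterion says
   |w|^2 >= 1 - eps.  Running the protocol backwards on phi (x) w gives the vector
   t = sum w_kl L_kl^* phi on ABR, which satisfies <t|psi> = |w|^2 and whose AR-marginal is at
   most (|A2|/|A1|) I (x) psi^R: the A1-marginal of Phi is I/|A1|, and reinserting A2 costs a factor
   |A2|.  This bounds the entanglement gain.  For the communication cost, purify a state
   of the smoothing ball that is at most m I to a vector v close to psi with v^A <= m I, and use
   w_kl = <phi|L_kl v> instead: the marginal of w on the encoder's environment is at most m |A1||A2| I, so the
   AR-marginal of t is at most m |A2|^2 I (x) psi^R. *)
theory Submission
  imports Defs
begin

text \<open>Closeness in trace norm implies no operator inequality for marginals, so a nearby vector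
  has to be built for which one holds; t is that vector. What makes its AR-marginal computable is
  that the decoder and its environment sit on the side that this marginal discards, where
  contractivity is enough. The encoder's environment does not, hence the only datum of w that enters
  is an operator bound \<kappa> for its marginal on the encoder's environment. Both results are
  instances of one estimate, t^AR at most \<kappa> |A2|/|A1| I (x) psi^R: the gain takes \<kappa> =
  1, since |w| is at most 1, and the cost takes \<kappa> = m |A1||A2|, where |A1| cancels. The error
  budget is linear: \<epsilon> from the protocol and 2 \<epsilon> from replacing psi by v, so
  <t|psi> is at least 1 - 3 \<epsilon>. By Uhlmann the same holds for the fidelity of the
  AR-marginals, and t^AR lies in the ball of radius \<delta> as soon as 6 \<epsilon> \<le>
  \<delta>^2. In the regime \<delta> < 1 this follows from \<delta> \<ge> 3 sqrt (3 sqrt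
  \<epsilon>). The inequalities obtained have no additive logarithm; those of the theorem are
  nonnegative.\<close>

subsection \<open>Adjoints and the inner product\<close>

text \<open>A rectangular version of \<open>dagger\<close>: Kraus operators and vectors reshaped
  across a cut are not square.\<close>

definition adj :: "complex ^ 'n ^ 'm \<Rightarrow> complex ^ 'm ^ 'n" where
  "adj M = (\<chi> i j. cnj (M $ j $ i))"

lemma dagger_eq_adj: "dagger M = adj M"
  by (simp add: dagger_def adj_def)

lemma adj_adj [simp]: "adj (adj M) = M"
  by (simp add: adj_def vec_eq_iff)

lemma adj_mult: "adj (A ** B) = adj B ** adj A"
  by (simp add: adj_def matrix_matrix_mult_def vec_eq_iff mult.commute)

lemma adj_diff: "adj (A - B) = adj A - adj B"
  and adj_mat_1 [simp]: "adj (mat 1) = mat 1"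
  by (auto simp: adj_def vec_eq_iff mat_def)

lemma cdot_adj: "cdot v (A *v w) = cdot (adj A *v v) w"
  unfolding cdot_def adj_def matrix_vector_mult_def
  by (simp add: sum_distrib_left sum_distrib_right mult_ac) (rule sum.swap)

lemma cdot_adj': "cdot (A *v v) w = cdot v (adj A *v w)"
  by (simp add: cdot_adj)

lemma cdot_commute: "cdot v w = cnj (cdot w v)"
  by (simp add: cdot_def mult.commute)

lemma cdot_add_left: "cdot (u + v) w = cdot u w + cdot v w"
  and cdot_add_right: "cdot w (u + v) = cdot w u + cdot w v"
  and cdot_diff_left: "cdot (u - v) w = cdot u w - cdot v w"
  and cdot_diff_right: "cdot w (u - v) = cdot w u - cdot w v"
  by (simp_all add: cdot_def algebra_simps sum.distrib sum_subtractf)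

lemma cdot_scale_left: "cdot (c *s v) w = cnj c * cdot v w"
  and cdot_scale_right: "cdot v (c *s w) = c * cdot v w"
  by (simp_all add: cdot_def sum_distrib_left mult_ac)

lemma cdot_zero [simp]: "cdot 0 v = 0" "cdot v 0 = 0"
  by (simp_all add: cdot_def)

lemma cdot_sum_right: "cdot w (\<Sum>i\<in>I. f i) = (\<Sum>i\<in>I. cdot w (f i))"
  by (induction I rule: infinite_finite_induct) (simp_all add: cdot_add_right)

lemma cdot_self: "cdot v v = of_real ((norm v)\<^sup>2)"
proof -
  have "cdot v v = of_real (\<Sum>i\<in>UNIV. (norm (v $ i))\<^sup>2)"
    unfolding of_real_sum complex_norm_square by (simp add: cdot_def mult.commute)
  then show ?thesis
    by (simp add: norm_vec_def L2_set_def sum_nonneg)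
qed

lemma norm_square_sum: "(norm v)\<^sup>2 = (\<Sum>i\<in>UNIV. (cmod (v $ i))\<^sup>2)"
  by (simp add: norm_vec_def L2_set_def sum_nonneg)

lemma inner_eq_cdot: "inner v w = Re (cdot v w)" for v w :: "complex ^ 'n"
  by (simp add: inner_vec_def cdot_def inner_complex_def)

lemma norm_scale_vec: "norm (c *s v) = cmod c * norm v" for v :: "complex ^ 'n"
proof -
  have "(norm (c *s v))\<^sup>2 = (cmod c * norm v)\<^sup>2"
    by (simp add: norm_square_sum norm_mult power_mult_distrib sum_distrib_left)
  then show ?thesis by simp
qed

lemma scaleR_eq_scale_vec: "t *\<^sub>R v = of_real t *s v" for v :: "complex ^ 'n"
  by (simp add: vec_eq_iff complex_eq_iff)

lemma cdot_Cauchy_Schwarz: "cmod (cdot v w) \<le> norm v * norm w"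
proof -
  \<comment> \<open>The phase c rotates the overlap onto its modulus, so the real Cauchy-Schwarz
    inequality applies.\<close>
  define c where "c = (if cdot v w = 0 then 1 else cnj (cdot v w) / cmod (cdot v w))"
  have c: "cmod c = 1"
    by (auto simp: c_def norm_divide)
  have "c * cdot v w = of_real (cmod (cdot v w))"
    by (auto simp: c_def field_simps complex_norm_square[symmetric] power2_eq_square[symmetric])
  then have "cmod (cdot v w) = inner v (c *s w)"
    by (simp add: inner_eq_cdot cdot_scale_right)
  also have "\<dots> \<le> norm v * norm (c *s w)"
    by (rule norm_cauchy_schwarz)
  finally show ?thesis
    by (simp add: norm_scale_vec c)
qed

lemma nonneg_Reals_iff: "z \<in> \<real>\<^sub>\<ge>\<^sub>0 \<longleftrightarrow> Re z \<ge> 0 \<and> Im z = 0"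
  by (auto simp: complex_nonneg_Reals_iff)

text \<open>Complex orthogonality to a vector is real orthogonality to it and to its multiple by the
  imaginary unit. So k vectors account for at most 2k of the 2 \<open>CARD('n)\<close> real
  dimensions.\<close>

lemma vec_complex_orth_exists:
  fixes f :: "nat \<Rightarrow> complex ^ 'n::finite"
  assumes "k < CARD('n)"
  obtains v where "v \<noteq> 0" "\<And>i. i < k \<Longrightarrow> cdot (f i) v = 0"
proof -
  define B where "B = f ` {..<k} \<union> (\<lambda>i. \<i> *s f i) ` {..<k}"
  have fin: "finite B" by (simp add: B_def)
  have "card B \<le> k + k"
    unfolding B_def by (metis add_mono card_Un_le card_image_le card_lessThan finite_lessThan le_trans)
  then have "dim (span B) < DIM(complex ^ 'n)"
    using dim_le_card'[OF fin] assms by simp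
  then obtain v where v: "v \<noteq> 0" "\<And>y. y \<in> span B \<Longrightarrow> orthogonal v y"
    using orthogonal_to_subspace_exists[of B] by auto
  have "cdot (f i) v = 0" if "i < k" for i
  proof -
    have "inner v (f i) = 0" "inner v (\<i> *s f i) = 0"
      using v(2)[of "f i"] v(2)[of "\<i> *s f i"] that
      by (auto simp: orthogonal_def B_def intro!: span_base)
    then have "cdot v (f i) = 0"
      by (simp add: inner_eq_cdot cdot_scale_right complex_eq_iff)
    then show ?thesis by (simp add: cdot_commute[of "f i"])
  qed
  with v(1) show ?thesis using that by blast
qed

subsection \<open>The spectral theorem\<close>

lemma psd_Re: "psd M \<Longrightarrow> Re (cdot v (M *v v)) \<ge> 0"
  and psd_Im: "psd M \<Longrightarrow> Im (cdot v (M *v v)) = 0"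
  by (auto simp: psd_def nonneg_Reals_iff)

lemma hermitian_quadratic_real:
  assumes "adj M = M" shows "Im (cdot v (M *v v)) = 0"
proof -
  have "cdot v (M *v v) = cnj (cdot v (M *v v))"
    by (metis assms cdot_adj cdot_commute)
  then show ?thesis by (simp add: complex_eq_iff)
qed

text \<open>Polarization: with a and b the two off-diagonal forms, evaluation at v + w gives a + b =
  0 and at v + \<i> w gives a - b = 0. This is how self-adjointness will follow from a real
  quadratic form.\<close>

lemma quadratic_form_eq_0:
  assumes q: "\<And>v. cdot v (N *v v) = 0" shows "N = 0"
proof -
  have "cdot v (N *v w) = 0" for v w
  proof -
    have "cdot v (N *v w) + cdot w (N *v v) = 0"
      using q[of "v + w"] q[of v] q[of w]
      by (simp add: cdot_add_left cdot_add_right matrix_vector_right_distrib add.commute)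
    moreover have "\<i> * cdot v (N *v w) - \<i> * cdot w (N *v v) = 0"
      using q[of "v + \<i> *s w"] q[of v] q[of w]
      by (simp add: cdot_add_left cdot_add_right matrix_vector_right_distrib
        cdot_scale_left cdot_scale_right vector_scalar_commute algebra_simps)
    ultimately show ?thesis
      by (simp add: algebra_simps)
  qed
  then have "N *v w = 0" for w
    using cdot_self[of "N *v w"] by simp
  then show ?thesis
    by (simp add: matrix_eq)
qed

lemma psd_iff: "psd M \<longleftrightarrow> adj M = M \<and> (\<forall>v. Re (cdot v (M *v v)) \<ge> 0)"
proof
  assume M: "psd M"
  have q: "cdot v ((M - adj M) *v v) = 0" for v
  proof -
    have "cdot v (M *v v) = cnj (cdot v (M *v v))"
      using psd_Im[OF M] by (simp add: complex_eq_iff)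
    also have "\<dots> = cdot v (adj M *v v)"
      by (metis cdot_adj' cdot_commute)
    finally show ?thesis
      by (simp add: matrix_vector_mult_diff_rdistrib cdot_diff_right)
  qed
  then have "M - adj M = 0"
    by (rule quadratic_form_eq_0)
  then show "adj M = M \<and> (\<forall>v. Re (cdot v (M *v v)) \<ge> 0)"
    using M by (simp add: psd_Re)
next
  assume "adj M = M \<and> (\<forall>v. Re (cdot v (M *v v)) \<ge> 0)"
  then show "psd M"
    by (auto simp: psd_def nonneg_Reals_iff hermitian_quadratic_real)
qed

lemma adj_psd: "psd M \<Longrightarrow> adj M = M"
  by (simp add: psd_iff)

text \<open>Induction on k: the next eigenvector maximizes the Rayleigh quotient q on the unit
  sphere of the orthogonal complement P of the previous ones. P is invariant under M, so the
  residual of the eigenvalue equation stays in P and is an admissible direction of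
  variation.\<close>

lemma hermitian_orthonormal_eigenvectors:
  fixes M :: "complex ^ 'n::finite ^ 'n"
  assumes M: "adj M = M" and "k \<le> CARD('n)"
  shows "\<exists>f. (\<forall>i<k. \<forall>j<k. cdot (f i) (f j) = (if i = j then 1 else 0)) \<and>
             (\<forall>i<k. \<exists>c::real. M *v f i = of_real c *s f i)"
  using assms(2)
proof (induction k)
  case 0
  then show ?case by simp
next
  case (Suc k)
  then obtain f where orth: "\<And>i j. i < k \<Longrightarrow> j < k \<Longrightarrow> cdot (f i) (f j) = (if i = j then 1 else 0)"
    and eig: "\<And>i. i < k \<Longrightarrow> \<exists>c::real. M *v f i = of_real c *s f i"
    by auto
  define P where "P = (\<Inter>i\<in>{..<k}. {x. cdot (f i) x = 0})"
  define q where "q x = inner x (M *v x)" for x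
  have q_scale: "q (r *s x) = (cmod r)\<^sup>2 * q x" for r x
    by (simp add: q_def inner_eq_cdot vector_scalar_commute cdot_scale_left cdot_scale_right
      flip: mult.assoc) (simp add: complex_mult_cnj cmod_power2 flip: power2_eq_square)
  have "closed P"
    unfolding P_def cdot_def by (intro closed_INT ballI closed_Collect_eq continuous_intros)
  then have "compact (sphere 0 1 \<inter> P)"
    by (intro compact_Int_closed compact_sphere)
  moreover have "sphere 0 1 \<inter> P \<noteq> {}"
  proof -
    obtain v where v: "v \<noteq> 0" "\<And>i. i < k \<Longrightarrow> cdot (f i) v = 0"
      using vec_complex_orth_exists[of k f] Suc.prems by auto
    then have "of_real (1 / norm v) *s v \<in> sphere 0 1 \<inter> P"
      by (simp add: P_def norm_scale_vec cdot_scale_right norm_divide)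
    then show ?thesis by blast
  qed
  moreover have "continuous_on (sphere 0 1 \<inter> P) q"
    unfolding q_def by (intro continuous_intros linear_continuous_on) auto
  ultimately obtain v where v: "v \<in> sphere 0 1 \<inter> P" "\<And>x. x \<in> sphere 0 1 \<inter> P \<Longrightarrow> q x \<le> q v"
    using continuous_attains_sup by metis
  have max: "q x \<le> q v * (norm x)\<^sup>2" if "x \<in> P" for x
  proof (cases "x = 0")
    case False
    then have "of_real (1 / norm x) *s x \<in> sphere 0 1 \<inter> P"
      using that by (simp add: P_def norm_scale_vec cdot_scale_right norm_divide)
    from v(2)[OF this] show ?thesis
      using False by (simp add: q_scale norm_divide divide_simps)
  qed (simp add: q_def)
  define w where "w = M *v v - of_real (q v) *s v"
  have MP: "M *v x \<in> P" if "x \<in> P" for x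
    unfolding P_def
  proof (intro INT_I CollectI)
    fix i assume "i \<in> {..<k}"
    moreover from this obtain c :: real where "M *v f i = of_real c *s f i"
      using eig by auto
    ultimately show "cdot (f i) (M *v x) = 0"
      using that by (simp add: cdot_adj M P_def cdot_scale_left)
  qed
  have vP: "v \<in> P" and nv: "norm v = 1"
    using v(1) by auto
  have wP: "w \<in> P"
    using MP[OF vP] vP by (auto simp: w_def P_def cdot_diff_right cdot_scale_right)
  have inner_w: "inner w (M *v v) = (norm w)\<^sup>2 + q v * inner w v"
    unfolding dot_square_norm[symmetric]
    by (simp add: w_def inner_diff_right inner_diff_left inner_eq_cdot cdot_scale_left
        cdot_scale_right cdot_diff_right cdot_diff_left algebra_simps)
  have sym: "inner v (M *v w) = inner w (M *v v)"
    using arg_cong[OF cdot_commute[of v "M *v w"], of Re]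
    by (simp add: inner_eq_cdot cdot_adj' M)
  have Mscale: "M *v (t *\<^sub>R w) = t *\<^sub>R (M *v w)" for t
    by (simp add: scaleR_eq_scale_vec vector_scalar_commute)
  define K where "K = q v * (norm w)\<^sup>2 - q w"
  \<comment> \<open>Maximality at v + t w: the terms of order 0 cancel, the linear term is 2 t
    |w|^2, and K collects the quadratic ones. This can hold for all small t > 0 only if w =
    0.\<close>
  have ineq: "2 * t * (norm w)\<^sup>2 \<le> t\<^sup>2 * K" for t :: real
  proof -
    have "v + t *\<^sub>R w \<in> P"
      using vP wP by (auto simp: P_def cdot_add_right scaleR_eq_scale_vec cdot_scale_right)
    from max[OF this] have "q (v + t *\<^sub>R w) \<le> q v * (norm (v + t *\<^sub>R w))\<^sup>2" .
    moreover have "q (v + t *\<^sub>R w) = q v + 2 * t * inner w (M *v v) + t\<^sup>2 * q w"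
      by (simp add: q_def matrix_vector_right_distrib Mscale
        inner_add_left inner_add_right sym power2_eq_square algebra_simps)
    moreover have "(norm (v + t *\<^sub>R w))\<^sup>2 = 1 + 2 * t * inner w v + t\<^sup>2 * (norm w)\<^sup>2"
      using nv unfolding dot_square_norm[symmetric]
      by (simp add: inner_add_left inner_add_right inner_commute power2_eq_square algebra_simps
        norm_eq_1)
    ultimately show ?thesis
      by (simp add: inner_w K_def algebra_simps)
  qed
  have "w = 0"
  proof (rule ccontr)
    assume "w \<noteq> 0"
    then have a: "(norm w)\<^sup>2 > 0" by simp
    define a where "a = (norm w)\<^sup>2"
    \<comment> \<open>This step size gives t K \<le> a, against the 2 a \<le> t K that
      \<open>ineq\<close> demands.\<close>
    define t where "t = a / (\<bar>K\<bar> + 1)"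
    have "t > 0" using a by (simp add: t_def a_def)
    have "2 * a \<le> t * K"
      using ineq[of t] \<open>t > 0\<close> by (simp add: a_def power2_eq_square)
    also have "t * K \<le> t * (\<bar>K\<bar> + 1)"
      using \<open>t > 0\<close> by (intro mult_left_mono) auto
    also have "\<dots> = a" by (simp add: t_def)
    finally show False using a by (simp add: a_def)
  qed
  then have eigv: "M *v v = of_real (q v) *s v" by (simp add: w_def)
  have fv: "cdot (f i) v = 0" "cdot v (f i) = 0" if "i < k" for i
    using vP that by (auto simp: P_def cdot_commute[of v])
  have vv: "cdot v v = 1" by (simp add: cdot_self nv)
  show ?case
    by (rule exI[of _ "f(k := v)"]) (use orth eig eigv fv vv in \<open>auto simp: less_Suc_eq\<close>)
qed

definition diag :: "('n \<Rightarrow> real) \<Rightarrow> complex ^ 'n ^ 'n" where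
  "diag d = (\<chi> i j. if i = j then of_real (d i) else 0)"

lemma diag_mult: "diag d ** diag e = diag (\<lambda>i. d i * e i)"
  by (simp add: diag_def matrix_matrix_mult_def vec_eq_iff mult_delta_left mult_delta_right)

lemma adj_diag [simp]: "adj (diag d) = diag d"
  by (simp add: diag_def adj_def vec_eq_iff)

lemma diag_mult_vec: "(diag d *v v) $ i = of_real (d i) * v $ i"
  by (simp add: diag_def matrix_vector_mult_def mult_delta_left)

lemma cdot_axis: "cdot (axis i 1) v = v $ i"
  by (simp add: cdot_def axis_def mult_delta_left if_distrib[of cnj] cong: if_cong)

theorem psd_spectral:
  fixes M :: "complex ^ 'n::finite ^ 'n"
  assumes "psd M"
  shows "\<exists>(U :: complex ^ 'n ^ 'n) d. adj U ** U = mat 1 \<and> U ** adj U = mat 1 \<and> (\<forall>i. d i \<ge> 0) \<and>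
    M = U ** diag d ** adj U"
proof -
  obtain f where orth: "\<And>i j. i < CARD('n) \<Longrightarrow> j < CARD('n) \<Longrightarrow> cdot (f i) (f j) = (if i = j then 1 else 0)"
    and eig: "\<And>i. i < CARD('n) \<Longrightarrow> \<exists>c::real. M *v f i = of_real c *s f i"
    using hermitian_orthonormal_eigenvectors[OF adj_psd[OF assms], of "CARD('n)"] by auto
  obtain g where g: "bij_betw g (UNIV :: 'n set) {..<CARD('n)}"
    using ex_bij_betw_finite_nat[of "UNIV :: 'n set"] by (auto simp: atLeast0LessThan)
  have gl: "g i < CARD('n)" for i
    using g by (auto simp: bij_betw_def)
  have ginj: "g i = g j \<longleftrightarrow> i = j" for i j
    using g by (auto simp: bij_betw_def inj_on_def)
  define d where "d i = (SOME c::real. M *v f (g i) = of_real c *s f (g i))" for i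
  have d: "M *v f (g i) = of_real (d i) *s f (g i)" for i
    unfolding d_def by (rule someI_ex) (rule eig[OF gl])
  define U where "U = (\<chi> i j. f (g j) $ i)"
  have U1: "adj U ** U = mat 1"
    using orth[OF gl gl]
    by (simp add: vec_eq_iff matrix_matrix_mult_def adj_def U_def mat_def cdot_def ginj)
  then have U2: "U ** adj U = mat 1"
    by (simp add: matrix_left_right_inverse)
  have MU: "M ** U = U ** diag d"
  proof -
    have "(M ** U) $ i $ j = (M *v f (g j)) $ i" for i j
      by (simp add: matrix_matrix_mult_def matrix_vector_mult_def U_def)
    moreover have "(U ** diag d) $ i $ j = of_real (d j) * f (g j) $ i" for i j
      by (simp add: U_def matrix_matrix_mult_def diag_def mult_delta_right mult.commute)
    ultimately show ?thesis
      by (simp add: d vec_eq_iff)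
  qed
  have "U ** diag d ** adj U = M ** (U ** adj U)"
    by (simp only: MU[symmetric] matrix_mul_assoc)
  then have M_eq: "M = U ** diag d ** adj U"
    by (simp only: U2 matrix_mul_rid)
  have d_nonneg: "d i \<ge> 0" for i
  proof -
    have "cdot (f (g i)) (M *v f (g i)) = of_real (d i)"
      by (simp add: d cdot_scale_right orth gl)
    then show ?thesis
      using psd_Re[OF assms, of "f (g i)"] by simp
  qed
  show ?thesis
    using U1 U2 d_nonneg M_eq by (intro exI conjI allI)
qed

subsection \<open>Square roots, polar decomposition, trace norm and fidelity\<close>

lemma mult_axis: "(A *v axis j 1) $ i = A $ i $ j" for A :: "'a::semiring_1 ^ 'n ^ 'm"
  by (simp add: matrix_vector_mult_def axis_def if_distrib[of "(*) _"] cong: if_cong)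

lemma matrix_diff_ldistrib: "A ** (B - C) = A ** B - A ** C"
  and matrix_diff_rdistrib: "(B - C) ** D = B ** D - C ** D"
  for B C :: "'a::ring_1 ^ 'n ^ 'm"
  by (simp_all add: matrix_matrix_mult_def vec_eq_iff algebra_simps sum_subtractf)

lemma psd_conj:
  assumes "psd P" shows "psd (A ** P ** adj A)"
proof -
  have "cdot v ((A ** P ** adj A) *v v) = cdot (adj A *v v) (P *v (adj A *v v))" for v
    by (simp add: cdot_adj' matrix_vector_mul_assoc matrix_mul_assoc)
  then show ?thesis
    using assms by (simp add: psd_def)
qed

lemma psd_diag: "(\<And>i. d i \<ge> 0) \<Longrightarrow> psd (diag d)"
  by (auto simp: psd_iff cdot_def diag_mult_vec mult.left_commute[of "cnj _"] complex_mult_cnj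
      complex_norm_square[symmetric] intro!: sum_nonneg)

lemma psd_gram: "psd (A ** adj A)"
  using psd_conj[of "diag (\<lambda>_. 1)" A] psd_diag[of "\<lambda>_. 1"]
  by (simp add: diag_def flip: mat_def)

lemma psd_gram': "psd (adj A ** A)"
  using psd_gram[of "adj A"] by simp

lemma cdot_gram: "cdot v ((A ** adj A) *v v) = of_real ((norm (adj A *v v))\<^sup>2)"
  by (simp add: cdot_adj[of v A] cdot_self flip: matrix_vector_mul_assoc)

text \<open>If u is an eigenvector of M with eigenvalue s^2, then x = S u - s u satisfies S x = - s
  x. For s > 0 positivity of S forces x = 0; for s = 0 the norm of x = S u vanishes because S x = 0.
  Uniqueness is what gives the definite description in \<open>psd_sqrt\<close> a value.\<close>

lemma psd_root_unique:
  fixes S M U :: "complex ^ 'n::finite ^ 'n"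
  assumes S: "psd S" "S ** S = M"
    and U: "adj U ** U = mat 1" "U ** adj U = mat 1" and d: "\<And>i. d i \<ge> 0"
    and M: "M = U ** diag d ** adj U"
  shows "S = U ** diag (\<lambda>i. sqrt (d i)) ** adj U"
proof -
  have col: "S *v (U *v axis i 1) = of_real (sqrt (d i)) *s (U *v axis i 1)" for i
  proof -
    define u where "u = U *v axis i 1"
    define s where "s = sqrt (d i)"
    define x where "x = S *v u - of_real s *s u"
    have Da: "diag d *v axis i 1 = of_real (d i) *s axis i 1"
      by (simp add: vec_eq_iff diag_mult_vec axis_def)
    have "S *v (S *v u) = (U ** diag d ** (adj U ** U)) *v axis i 1"
      by (simp add: u_def S M matrix_vector_mul_assoc matrix_mul_assoc)
    also have "\<dots> = U *v (diag d *v axis i 1)"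
      by (simp add: U matrix_vector_mul_assoc)
    also have "\<dots> = of_real (d i) *s u"
      unfolding Da by (simp add: u_def vector_scalar_commute)
    finally have SS: "S *v (S *v u) = of_real (s * s) *s u"
      using d by (simp add: s_def)
    then have Sx: "S *v x = of_real (- s) *s x"
      by (simp add: x_def matrix_vector_mult_diff_distrib vector_scalar_commute vec_eq_iff algebra_simps)
    have "x = 0"
    proof (cases "s = 0")
      case True
      have "cdot x x = 0"
        using Sx True by (simp add: x_def cdot_adj'[of S] adj_psd[OF S(1)])
      then show ?thesis by (simp add: cdot_self)
    next
      case False
      then have "s > 0" using d[of i] by (simp add: s_def order_less_le)
      have "0 \<le> - s * (norm x)\<^sup>2"
        using psd_Re[OF S(1), of x] unfolding Sx cdot_scale_right cdot_self
        by (simp flip: of_real_power)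
      with \<open>s > 0\<close> show ?thesis
        by (simp add: mult_le_0_iff)
    qed
    then show ?thesis by (simp add: x_def u_def s_def)
  qed
  have "S ** U = U ** diag (\<lambda>i. sqrt (d i))"
  proof -
    have "(A ** U) $ k $ i = (A *v (U *v axis i 1)) $ k" for A :: "complex ^ 'n ^ 'n" and k i
      by (simp add: matrix_vector_mul_assoc mult_axis)
    moreover have "(U ** diag (\<lambda>i. sqrt (d i))) $ k $ i = of_real (sqrt (d i)) * (U *v axis i 1) $ k" for k i
      by (simp add: mult_axis matrix_matrix_mult_def diag_def mult_delta_right mult.commute)
    ultimately show ?thesis by (simp add: vec_eq_iff col)
  qed
  then have "U ** diag (\<lambda>i. sqrt (d i)) ** adj U = S ** (U ** adj U)"
    by (simp only: matrix_mul_assoc)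
  then show ?thesis by (simp add: U)
qed

lemma unitary_conj_mult:
  assumes "adj U ** U = mat 1"
  shows "(U ** A ** adj U) ** (U ** B ** adj U) = U ** (A ** B) ** adj U"
proof -
  have "(U ** A ** adj U) ** (U ** B ** adj U) = U ** A ** (adj U ** U) ** B ** adj U"
    by (simp only: matrix_mul_assoc)
  then show ?thesis by (simp add: assms matrix_mul_assoc)
qed

lemma psd_sqrt_spectral:
  fixes M U :: "complex ^ 'n::finite ^ 'n"
  assumes U: "adj U ** U = mat 1" "U ** adj U = mat 1" and d: "\<And>i. d i \<ge> 0"
    and M: "M = U ** diag d ** adj U"
  shows "psd_sqrt M = U ** diag (\<lambda>i. sqrt (d i)) ** adj U"
  unfolding psd_sqrt_def
proof (rule the_equality)
  show "psd (U ** diag (\<lambda>i. sqrt (d i)) ** adj U) \<and>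
    U ** diag (\<lambda>i. sqrt (d i)) ** adj U ** (U ** diag (\<lambda>i. sqrt (d i)) ** adj U) = M"
    unfolding unitary_conj_mult[OF U(1)]
    using d by (auto intro!: psd_conj psd_diag simp: diag_mult M)
next
  fix S assume "psd S \<and> S ** S = M"
  then show "S = U ** diag (\<lambda>i. sqrt (d i)) ** adj U"
    using psd_root_unique[of S M U d] assms by blast
qed

lemma psd_psd_sqrt: "psd M \<Longrightarrow> psd (psd_sqrt M)"
  and psd_sqrt_mult_self: "psd M \<Longrightarrow> psd_sqrt M ** psd_sqrt M = M"
proof -
  fix M :: "complex ^ 'n::finite ^ 'n"
  assume M: "psd M"
  obtain U :: "complex ^ 'n ^ 'n" and d where U: "adj U ** U = mat 1" "U ** adj U = mat 1" and d: "\<And>i. d i \<ge> 0"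
    and M_eq: "M = U ** diag d ** adj U"
    using psd_spectral[OF M] by blast
  note sq = psd_sqrt_spectral[OF U d M_eq]
  show "psd (psd_sqrt M)"
    unfolding sq using d by (auto intro!: psd_conj psd_diag)
  show "psd_sqrt M ** psd_sqrt M = M"
    unfolding sq unitary_conj_mult[OF U(1)] using d by (simp add: diag_mult M_eq)
qed

section \<open>Contractions and the polar decomposition\<close>

definition contraction :: "complex ^ 'n ^ 'm \<Rightarrow> bool" where
  "contraction C \<longleftrightarrow> (\<forall>v. norm (C *v v) \<le> norm v)"

lemma contraction_mult: "contraction A \<Longrightarrow> contraction B \<Longrightarrow> contraction (A ** B)"
  unfolding contraction_def by (metis matrix_vector_mul_assoc order_trans)

lemma contraction_adj:
  assumes "contraction C" shows "contraction (adj C)"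
  unfolding contraction_def
proof
  fix v
  have "(norm (adj C *v v))\<^sup>2 = cmod (cdot v (C *v (adj C *v v)))"
    by (simp add: cdot_adj cdot_self norm_power)
  also have "\<dots> \<le> norm v * norm (adj C *v v)"
    using assms cdot_Cauchy_Schwarz[of v "C *v (adj C *v v)"]
    by (meson contraction_def mult_left_mono norm_ge_zero order_trans)
  finally show "norm (adj C *v v) \<le> norm v"
    by (cases "norm (adj C *v v) = 0") (auto simp: power2_eq_square)
qed

lemma contraction_entry: "contraction C \<Longrightarrow> cmod (C $ i $ j) \<le> 1"
proof -
  assume C: "contraction C"
  have ax: "norm (axis k (1::complex)) = 1" for k
    by (simp add: norm_axis_1)
  have "C $ i $ j = cdot (axis i 1) (C *v axis j 1)"
    by (simp add: cdot_axis mult_axis)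
  also have "cmod \<dots> \<le> norm (axis i (1::complex)) * norm (C *v axis j 1)"
    by (rule cdot_Cauchy_Schwarz)
  also have "\<dots> \<le> 1"
    using C[unfolded contraction_def, rule_format, of "axis j 1"] by (simp add: ax)
  finally show ?thesis .
qed

lemma contraction_isometry: "adj U ** U = mat 1 \<Longrightarrow> contraction U"
proof -
  assume U: "adj U ** U = mat 1"
  have "(norm (U *v v))\<^sup>2 = (norm v)\<^sup>2" for v
  proof -
    have "cdot (U *v v) (U *v v) = cdot v v"
      by (simp add: cdot_adj' matrix_vector_mul_assoc U)
    then show ?thesis by (metis cdot_self of_real_eq_iff)
  qed
  then show ?thesis by (simp add: contraction_def)
qed

lemma trace_mult_commute: "trace (A ** B) = trace (B ** A)"
  for A :: "'a::comm_semiring_1 ^ 'n ^ 'm" and B :: "'a ^ 'm ^ 'n"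
  unfolding trace_def matrix_matrix_mult_def
  by (simp add: mult.commute) (rule sum.swap)

lemma gram_eq_0: "adj X ** X = 0 \<Longrightarrow> X = 0"
proof -
  assume X: "adj X ** X = 0"
  have "X *v v = 0" for v
  proof -
    have "cdot (X *v v) (X *v v) = 0"
      by (simp add: cdot_adj' matrix_vector_mul_assoc X)
    then show ?thesis by (simp add: cdot_self)
  qed
  then show ?thesis by (simp add: matrix_eq)
qed

text \<open>W is the pseudo-inverse of |X| times the adjoint of X, a partial isometry rather than a
  unitary, so X may be rectangular and of any rank. Passing from X to |X| and back are then two
  separate identities.\<close>

theorem polar_decomposition:
  fixes X :: "complex ^ 'n::finite ^ 'm::finite"
  obtains W :: "complex ^ 'm ^ 'n" where "contraction W"
    "W ** X = psd_sqrt (adj X ** X)" "adj W ** psd_sqrt (adj X ** X) = X"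
proof -
  obtain U :: "complex ^ 'n ^ 'n" and d where U: "adj U ** U = mat 1" "U ** adj U = mat 1" and d: "\<And>i. d i \<ge> 0"
    and XX: "adj X ** X = U ** diag d ** adj U"
    using psd_spectral[OF psd_gram'[of X]] by (elim exE conjE) (rule that; simp only:)
  define D where "D f = U ** diag (\<lambda>i. f (d i)) ** adj U" for f
  define S where "S = D sqrt"
  \<comment> \<open>As 1 / 0 = 0, T is the pseudo-inverse of S, and P is the projection onto the
    support of S.\<close>
  define T where "T = D (\<lambda>x. 1 / sqrt x)"
  define P where "P = D (\<lambda>x. if x = 0 then 0 else 1)"
  have DD: "D f ** D g = D (\<lambda>x. f x * g x)" for f g
    by (simp add: D_def unitary_conj_mult[OF U(1)] diag_mult)
  have adjD: "adj (D f) = D f" for f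
    by (simp add: D_def adj_mult matrix_mul_assoc)
  have D_cong: "D f = D g" if "\<And>x. x \<ge> 0 \<Longrightarrow> f x = g x" for f g
    using that d by (simp add: D_def)
  have sq: "psd_sqrt (adj X ** X) = S"
    unfolding S_def D_def by (rule psd_sqrt_spectral[OF U d XX])
  have XS: "adj X ** X = S ** S"
    unfolding S_def DD by (simp add: XX D_def d)
  have TS: "T ** S = P" "S ** T = P" and PS: "P ** S = S" and SP: "S ** P = S"
    unfolding S_def T_def P_def DD by (rule D_cong; simp)+
  have PP: "P ** P = P"
    unfolding P_def DD by (rule D_cong) simp
  define W where "W = T ** adj X"
  have "W ** X = T ** (adj X ** X)"
    by (simp add: W_def matrix_mul_assoc)
  also have "\<dots> = S"
    by (simp add: XS matrix_mul_assoc TS PS)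
  finally have WX: "W ** X = S" .
  have adjT: "adj T = T"
    by (simp add: T_def adjD)
  have adjW: "adj W = X ** T"
    by (simp add: W_def adj_mult adjT)
  \<comment> \<open>X vanishes off the support of S, because its Gram matrix is S squared and S P =
    S.\<close>
  have "adj (X ** (mat 1 - P)) ** (X ** (mat 1 - P)) = (mat 1 - P) ** (adj X ** X) ** (mat 1 - P)"
    by (simp add: adj_mult adj_diff P_def adjD matrix_mul_assoc)
  also have "\<dots> = 0"
    unfolding XS by (simp add: matrix_diff_ldistrib matrix_diff_rdistrib matrix_mul_assoc[symmetric] SP)
  finally have "X ** (mat 1 - P) = 0"
    by (rule gram_eq_0)
  then have "adj W ** S = X"
    by (simp add: adjW matrix_mul_assoc[symmetric] TS matrix_diff_ldistrib)
  moreover have "contraction W"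
  proof -
    have "adj (adj W) ** adj W = T ** (adj X ** X) ** T"
      by (simp only: adjW adj_mult adjT matrix_mul_assoc)
    also have "\<dots> = (T ** S) ** (S ** T)"
      by (simp only: XS matrix_mul_assoc)
    also have "\<dots> = P" by (simp add: TS PP)
    finally have WW: "adj (adj W) ** adj W = P" .
    have "contraction (diag (\<lambda>i. if d i = 0 then 0 else 1))"
      unfolding contraction_def
    proof
      fix v
      have "(norm (diag (\<lambda>i. if d i = 0 then 0 else 1) *v v))\<^sup>2 \<le> (norm v)\<^sup>2"
        unfolding norm_square_sum by (intro sum_mono) (simp add: diag_mult_vec)
      then show "norm (diag (\<lambda>i. if d i = 0 then 0 else 1) *v v) \<le> norm v"
        by (rule power2_le_imp_le) simp
    qed
    then have "contraction P"
      unfolding P_def D_def using contraction_isometry[OF U(1)]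
      by (intro contraction_mult contraction_adj)
    have "contraction (adj W)"
      unfolding contraction_def
    proof
      fix v
      have "(norm (adj W *v v))\<^sup>2 = cmod (cdot v (P *v v))"
        unfolding WW[symmetric]
        by (simp add: cdot_adj[of v W] cdot_self norm_power flip: matrix_vector_mul_assoc)
      also have "\<dots> \<le> norm v * norm v"
        using \<open>contraction P\<close> unfolding contraction_def
        by (intro order_trans[OF cdot_Cauchy_Schwarz] mult_left_mono) auto
      finally show "norm (adj W *v v) \<le> norm v"
        unfolding power2_eq_square[of "norm v", symmetric] by (rule power2_le_imp_le) simp
    qed
    from contraction_adj[OF this] show ?thesis by simp
  qed
  ultimately show ?thesis
    using that[of W] WX unfolding sq by simp
qed

text \<open>One half of the duality between trace norm and operator norm. In an eigenbasis of |X|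
  the trace becomes the sum of the eigenvalues of |X| weighted by the diagonal entries of a
  contraction N, and these have real part at most 1.\<close>

lemma trace_norm_ge:
  fixes X C :: "complex ^ 'n::finite ^ 'n"
  assumes "contraction C"
  shows "Re (trace (C ** X)) \<le> trace_norm X"
proof -
  let ?S = "psd_sqrt (adj X ** X)"
  obtain W where W: "contraction W" "adj W ** ?S = X"
    using polar_decomposition[of X] by metis
  obtain U :: "complex ^ 'n ^ 'n" and d where U: "adj U ** U = mat 1" "U ** adj U = mat 1" and d: "\<And>i. d i \<ge> 0"
    and S: "?S = U ** diag d ** adj U"
    using psd_spectral[OF psd_psd_sqrt[OF psd_gram'[of X]]] by blast
  define N where "N = adj U ** (C ** adj W) ** U"
  have N: "contraction N"
    unfolding N_def using W assms contraction_isometry[OF U(1)]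
    by (intro contraction_mult contraction_adj)
  have "trace (C ** X) = trace (C ** (adj W ** ?S))"
    by (simp add: W)
  also have "\<dots> = trace ((C ** adj W ** U ** diag d) ** adj U)"
    by (simp only: S matrix_mul_assoc)
  also have "\<dots> = trace (N ** diag d)"
    by (subst trace_mult_commute) (simp add: N_def matrix_mul_assoc)
  also have "\<dots> = (\<Sum>i\<in>UNIV. N $ i $ i * of_real (d i))"
    by (simp add: trace_def matrix_matrix_mult_def diag_def mult_delta_right)
  finally have "Re (trace (C ** X)) = (\<Sum>i\<in>UNIV. Re (N $ i $ i) * d i)"
    by simp
  also have "\<dots> \<le> (\<Sum>i\<in>UNIV. 1 * d i)"
    by (intro sum_mono mult_right_mono d order_trans[OF complex_Re_le_cmod contraction_entry[OF N]])
  also have "\<dots> = Re (trace (diag d))"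
    by (simp add: trace_def diag_def)
  also have "trace (diag d) = trace (?S)"
    unfolding S by (subst trace_mult_commute) (simp add: matrix_mul_assoc U)
  finally show ?thesis
    by (simp add: trace_norm_def dagger_eq_adj)
qed

lemma trace_norm_attained:
  fixes X :: "complex ^ 'n::finite ^ 'n"
  obtains C where "contraction C" "Re (trace (C ** X)) = trace_norm X"
  using polar_decomposition[of X] by (metis trace_norm_def dagger_eq_adj)

text \<open>The easy half of Uhlmann's theorem. X and Y are vectors reshaped to matrices, their Gram
  matrices are the marginals, and the trace is the overlap of the vectors. The polar factors of both
  combine to one contraction tested against the product of the square roots.\<close>

lemma fidelity_gram_ge:
  fixes X Y :: "complex ^ 'e::finite ^ 'n::finite"
  shows "Re (trace (adj X ** Y)) \<le> fidelity (X ** adj X) (Y ** adj Y)"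
proof -
  let ?S = "psd_sqrt (X ** adj X)" and ?T = "psd_sqrt (Y ** adj Y)"
  obtain W where W: "contraction W" "adj W ** ?S = adj X"
    using polar_decomposition[of "adj X"] by (metis adj_adj)
  obtain V where V: "contraction V" "adj V ** ?T = adj Y"
    using polar_decomposition[of "adj Y"] by (metis adj_adj)
  have "Y = ?T ** V"
    using arg_cong[OF V(2), of adj] by (simp add: adj_mult adj_psd psd_psd_sqrt psd_gram)
  then have "trace (adj X ** Y) = trace ((adj W ** ?S) ** (?T ** V))"
    using W(2) by simp
  also have "\<dots> = trace ((adj W ** (?S ** ?T)) ** V)"
    by (simp add: matrix_mul_assoc)
  also have "\<dots> = trace ((V ** adj W) ** (?S ** ?T))"
    by (subst trace_mult_commute) (simp add: matrix_mul_assoc)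
  finally show ?thesis
    unfolding fidelity_def
    using trace_norm_ge[of "V ** adj W" "?S ** ?T"] W(1) V(1)
    by (simp add: contraction_mult contraction_adj)
qed

text \<open>The other half of Uhlmann's theorem, for a purifying space fixed in advance. That space
  may be too small to purify \<rho>, so Z is built from contractions instead of a unitary and its
  Gram matrix is only dominated by \<rho>. Domination is enough to transfer an upper bound on
  \<rho>.\<close>

lemma fidelity_gram_attained:
  fixes Y :: "complex ^ 'e::finite ^ 'n::finite"
  assumes "psd \<rho>"
  obtains Z :: "complex ^ 'e ^ 'n" where
    "\<And>v. (norm (adj Z *v v))\<^sup>2 \<le> Re (cdot v (\<rho> *v v))"
    "Re (trace (adj Z ** Y)) = fidelity \<rho> (Y ** adj Y)"
proof -
  let ?S = "psd_sqrt \<rho>" and ?T = "psd_sqrt (Y ** adj Y)"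
  obtain V where V: "contraction V" "V ** adj Y = ?T"
    using polar_decomposition[of "adj Y"] by (metis adj_adj)
  obtain C where C: "contraction C" "Re (trace (C ** (?S ** ?T))) = fidelity \<rho> (Y ** adj Y)"
    unfolding fidelity_def using trace_norm_attained by blast
  define Z where "Z = adj (adj V ** C ** ?S)"
  have T: "?T = Y ** adj V"
    using arg_cong[OF V(2), of adj] by (simp add: adj_mult adj_psd psd_psd_sqrt psd_gram)
  have "trace (adj Z ** Y) = trace (adj V ** (C ** ?S ** Y))"
    by (simp add: Z_def matrix_mul_assoc)
  also have "\<dots> = trace (C ** (?S ** ?T))"
    by (subst trace_mult_commute) (simp add: T matrix_mul_assoc)
  finally have "Re (trace (adj Z ** Y)) = fidelity \<rho> (Y ** adj Y)"
    by (simp add: C)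
  moreover have "(norm (adj Z *v v))\<^sup>2 \<le> Re (cdot v (\<rho> *v v))" for v
  proof -
    have "contraction (adj V ** C)"
      using V C by (simp add: contraction_mult contraction_adj)
    then have "(norm (adj Z *v v))\<^sup>2 \<le> (norm (?S *v v))\<^sup>2"
      by (auto simp: Z_def contraction_def matrix_vector_mul_assoc[symmetric] intro!: power_mono)
    also have "\<dots> = Re (cdot v (\<rho> *v v))"
      using cdot_gram[of v ?S] assms by (simp add: adj_psd psd_psd_sqrt psd_sqrt_mult_self)
    finally show ?thesis .
  qed
  ultimately show ?thesis using that by blast
qed

subsection \<open>Kraus operators\<close>

lemma sum_UNIV_prod: "(\<Sum>x\<in>UNIV. f x) = (\<Sum>a\<in>UNIV. \<Sum>b\<in>UNIV. f (a, b))"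
  for f :: "'a::finite \<times> 'b::finite \<Rightarrow> 'c::comm_monoid_add"
  by (simp add: sum.cartesian_product flip: UNIV_Times_UNIV)

text \<open>Equivalently, the operators stacked on top of each other form an isometry into the
  output and its environment. No separate Stinespring space is then required.\<close>

definition kraus_family :: "('k::finite \<Rightarrow> complex ^ 'm ^ 'n) \<Rightarrow> bool" where
  "kraus_family K \<longleftrightarrow> (\<Sum>k\<in>UNIV. adj (K k) ** K k) = mat 1"

lemma matrix_vector_sum_left: "(\<Sum>k\<in>I. A k) *v v = (\<Sum>k\<in>I. A k *v v)"
  by (induction I rule: infinite_finite_induct) (simp_all add: matrix_vector_mult_add_rdistrib)

lemma matrix_vector_sum_right: "A *v (\<Sum>k\<in>I. v k) = (\<Sum>k\<in>I. A *v v k)"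
  by (induction I rule: infinite_finite_induct) (simp_all add: matrix_vector_right_distrib)

lemma kraus_family_norm:
  assumes "kraus_family K"
  shows "(\<Sum>k\<in>UNIV. (norm (K k *v v))\<^sup>2) = (norm v)\<^sup>2"
proof -
  have "of_real (\<Sum>k\<in>UNIV. (norm (K k *v v))\<^sup>2) = cdot v ((\<Sum>k\<in>UNIV. adj (K k) ** K k) *v v)"
    by (simp add: matrix_vector_sum_left cdot_sum_right cdot_self
        cdot_adj[of v "adj _"] flip: matrix_vector_mul_assoc)
  also have "\<dots> = of_real ((norm v)\<^sup>2)"
    using assms by (simp add: kraus_family_def cdot_self)
  finally show ?thesis
    by (simp only: of_real_eq_iff)
qed

text \<open>The adjoint of the stacked isometry is a contraction. Pairing y with itself moves each K
  k onto y; the inequality of arithmetic and geometric means then returns half of |y|^2, which is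
  absorbed on the left.\<close>

lemma kraus_family_adj_norm:
  assumes "kraus_family K"
  shows "(norm (\<Sum>k\<in>UNIV. adj (K k) *v u k))\<^sup>2 \<le> (\<Sum>k\<in>UNIV. (norm (u k))\<^sup>2)"
proof -
  have am: "a * b \<le> (a\<^sup>2 + b\<^sup>2) / 2" for a b :: real
    using sum_squares_bound[of a b] by simp
  define y where "y = (\<Sum>k\<in>UNIV. adj (K k) *v u k)"
  have "(norm y)\<^sup>2 = Re (cdot y y)"
    by (simp add: cdot_self)
  also have "cdot y y = (\<Sum>k\<in>UNIV. cdot (K k *v y) (u k))"
    by (subst (2) y_def) (simp add: cdot_sum_right cdot_adj[of y])
  also have "Re \<dots> \<le> (\<Sum>k\<in>UNIV. norm (K k *v y) * norm (u k))"
    by (simp add: sum_mono order_trans[OF complex_Re_le_cmod cdot_Cauchy_Schwarz])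
  also have "\<dots> \<le> (\<Sum>k\<in>UNIV. ((norm (K k *v y))\<^sup>2 + (norm (u k))\<^sup>2) / 2)"
    by (intro sum_mono am)
  also have "\<dots> = ((norm y)\<^sup>2 + (\<Sum>k\<in>UNIV. (norm (u k))\<^sup>2)) / 2"
    by (simp add: kraus_family_norm[OF assms] sum.distrib flip: sum_divide_distrib)
  finally show ?thesis by (simp add: y_def)
qed

section \<open>From complete positivity to Kraus operators by the Choi matrix\<close>

definition munit :: "'m \<Rightarrow> 'm \<Rightarrow> 'm::finite op" where
  "munit a b = (\<chi> i j. if i = a \<and> j = b then 1 else 0)"

lemma complex_linear_map_sum:
  assumes "complex_linear_map T"
  shows "T (\<Sum>k\<in>I. X k) = (\<Sum>k\<in>I. T (X k))"
proof -
  have "T (0 + 0) = T 0 + T 0"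
    using assms unfolding complex_linear_map_def by blast
  then have "T 0 = 0" by simp
  moreover have "T (X + Y) = T X + T Y" for X Y
    using assms unfolding complex_linear_map_def by blast
  ultimately show ?thesis
    by (induction I rule: infinite_finite_induct) simp_all
qed

lemma complex_linear_map_munit:
  assumes "complex_linear_map T"
  shows "T X = (\<Sum>a\<in>UNIV. \<Sum>b\<in>UNIV. cscale (X $ a $ b) (T (munit a b)))"
proof -
  have "X = (\<Sum>a\<in>UNIV. \<Sum>b\<in>UNIV. cscale (X $ a $ b) (munit a b))"
  proof -
    have "(\<Sum>a\<in>UNIV. \<Sum>b\<in>UNIV. X $ a $ b * (if i = a \<and> j = b then 1 else 0)) = X $ i $ j" for i j
    proof -
      have "(\<Sum>a\<in>UNIV. \<Sum>b\<in>UNIV. X $ a $ b * (if i = a \<and> j = b then 1 else 0)) =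
          (\<Sum>a\<in>UNIV. if a = i then \<Sum>b\<in>UNIV. if b = j then X $ a $ b else 0 else 0)"
        by (intro sum.cong refl) (auto simp: mult_delta_right)
      also have "\<dots> = X $ i $ j" by simp
      finally show ?thesis .
    qed
    then show ?thesis
      by (simp add: vec_eq_iff cscale_def munit_def)
  qed
  then have "T X = T (\<Sum>a\<in>UNIV. \<Sum>b\<in>UNIV. cscale (X $ a $ b) (munit a b))"
    by simp
  also have "\<dots> = (\<Sum>a\<in>UNIV. \<Sum>b\<in>UNIV. cscale (X $ a $ b) (T (munit a b)))"
    using assms by (simp add: complex_linear_map_sum[OF assms] complex_linear_map_def)
  finally show ?thesis .
qed

definition choi :: "('m::finite op \<Rightarrow> 'n::finite op) \<Rightarrow> ('m \<times> 'n) op" where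
  "choi T = (\<chi> x y. T (munit (fst x) (fst y)) $ snd x $ snd y)"

text \<open>The block matrix whose blocks are the matrix units is the projector onto the maximally
  entangled vector up to a factor: its form at w is the squared modulus of the sum of the w i at
  coordinate g i. The enumeration g bridges the ancilla indexed by natural numbers and the index
  type.\<close>

lemma psd_choi:
  fixes T :: "'m::finite op \<Rightarrow> 'n::finite op"
  assumes "completely_positive T"
  shows "psd (choi T)"
  unfolding psd_def
proof
  fix v :: "complex ^ ('m \<times> 'n)"
  obtain g where g: "bij_betw g {..<CARD('m)} (UNIV :: 'm set)"
    using ex_bij_betw_nat_finite[of "UNIV :: 'm set"] by (auto simp: atLeast0LessThan)
  have "block_psd CARD('m) (\<lambda>i j. munit (g i) (g j))"
    unfolding block_psd_def
  proof
    fix w :: "nat \<Rightarrow> complex ^ 'm"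
    have "cdot x (munit a b *v y) = cnj (x $ a) * y $ b" for x y :: "complex ^ 'm" and a b
    proof -
      have "munit a b *v y = y $ b *s axis a 1"
        by (auto simp: vec_eq_iff munit_def matrix_vector_mult_def axis_def mult_delta_left)
      then show ?thesis
        by (simp add: cdot_scale_right cdot_commute[of x] cdot_axis)
    qed
    then have "(\<Sum>i<CARD('m). \<Sum>j<CARD('m). cdot (w i) (munit (g i) (g j) *v w j)) =
       cnj (\<Sum>i<CARD('m). w i $ g i) * (\<Sum>j<CARD('m). w j $ g j)"
      by (simp add: sum_product)
    then show "(\<Sum>i<CARD('m). \<Sum>j<CARD('m). cdot (w i) (munit (g i) (g j) *v w j)) \<in> \<real>\<^sub>\<ge>\<^sub>0"
      by (simp add: nonneg_Reals_iff del: cnj_sum)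
  qed
  then have "block_psd CARD('m) (\<lambda>i j. T (munit (g i) (g j)))"
    using assms unfolding completely_positive_def by blast
  from this[unfolded block_psd_def, rule_format, of "\<lambda>i. \<chi> p. v $ (g i, p)"]
  have "(\<Sum>i<CARD('m). \<Sum>j<CARD('m).
      cdot (\<chi> p. v $ (g i, p)) (T (munit (g i) (g j)) *v (\<chi> p. v $ (g j, p)))) \<in> \<real>\<^sub>\<ge>\<^sub>0" .
  also have "(\<Sum>i<CARD('m). \<Sum>j<CARD('m).
      cdot (\<chi> p. v $ (g i, p)) (T (munit (g i) (g j)) *v (\<chi> p. v $ (g j, p)))) =
      (\<Sum>a\<in>UNIV. \<Sum>b\<in>UNIV. cdot (\<chi> p. v $ (a, p)) (T (munit a b) *v (\<chi> p. v $ (b, p))))"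
    by (subst sum.reindex_bij_betw[OF g, symmetric], subst sum.reindex_bij_betw[OF g, symmetric]) simp
  also have "\<dots> = cdot v (choi T *v v)"
    by (simp add: cdot_def matrix_vector_mult_def choi_def sum_UNIV_prod sum_distrib_left)
      (intro sum.cong refl sum.swap)
  finally show "cdot v (choi T *v v) \<in> \<real>\<^sub>\<ge>\<^sub>0" .
qed

text \<open>The Kraus operators are the columns of the square root of the Choi matrix, each reshaped
  to a matrix from input to output. Trace preservation on matrix units is, entry by entry, their
  completeness relation.\<close>

theorem cptp_kraus:
  fixes T :: "'m::finite op \<Rightarrow> 'n::finite op"
  assumes "cptp T"
  shows "\<exists>K :: 'm \<times> 'n \<Rightarrow> complex ^ 'm ^ 'n.
    kraus_family K \<and> (\<forall>X. T X = (\<Sum>k\<in>UNIV. K k ** X ** adj (K k)))"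
proof -
  have lin: "complex_linear_map T" and cp: "completely_positive T" and tp: "trace_preserving T"
    using assms by (auto simp: cptp_def)
  define G where "G = psd_sqrt (choi T)"
  have G: "choi T = G ** adj G"
    using psd_choi[OF cp] by (simp add: G_def adj_psd psd_psd_sqrt psd_sqrt_mult_self)
  have TG: "T (munit a b) $ p $ q = (\<Sum>k\<in>UNIV. G $ (a, p) $ k * cnj (G $ (b, q) $ k))" for a b p q
  proof -
    have "T (munit a b) $ p $ q = choi T $ (a, p) $ (b, q)"
      by (simp add: choi_def)
    then show ?thesis
      by (simp add: G matrix_matrix_mult_def adj_def)
  qed
  define K where "K k = (\<chi> p a. G $ (a, p) $ k)" for k
  have "T X = (\<Sum>k\<in>UNIV. K k ** X ** adj (K k))" for X
  proof -
    have "T X $ p $ q = (\<Sum>k\<in>UNIV. K k ** X ** adj (K k)) $ p $ q" for p q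
    proof -
      have "T X $ p $ q = (\<Sum>a\<in>UNIV. \<Sum>b\<in>UNIV. \<Sum>k\<in>UNIV. X $ a $ b * (G $ (a, p) $ k * cnj (G $ (b, q) $ k)))"
        by (subst complex_linear_map_munit[OF lin]) (simp add: cscale_def TG sum_distrib_left)
      also have "\<dots> = (\<Sum>k\<in>UNIV. \<Sum>b\<in>UNIV. \<Sum>a\<in>UNIV. X $ a $ b * (G $ (a, p) $ k * cnj (G $ (b, q) $ k)))"
        by (subst (2) sum.swap, subst sum.swap, intro sum.cong refl, rule sum.swap)
      also have "\<dots> = (\<Sum>k\<in>UNIV. K k ** X ** adj (K k)) $ p $ q"
        by (simp add: K_def matrix_matrix_mult_def adj_def sum_distrib_left sum_distrib_right mult_ac)
      finally show ?thesis .
    qed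
    then show ?thesis by (simp add: vec_eq_iff)
  qed
  moreover have "kraus_family K"
  proof -
    have "(\<Sum>k\<in>UNIV. adj (K k) ** K k) $ b $ a = mat 1 $ b $ a" for a b
    proof -
      have "(\<Sum>k\<in>UNIV. adj (K k) ** K k) $ b $ a = (\<Sum>p\<in>UNIV. T (munit a b) $ p $ p)"
        by (simp add: matrix_matrix_mult_def adj_def K_def TG mult.commute) (rule sum.swap)
      also have "\<dots> = trace (munit a b :: 'm op)"
        using tp by (simp add: trace_preserving_def flip: trace_def)
      also have "\<dots> = mat 1 $ b $ a"
        by (auto simp: trace_def munit_def mat_def intro!: sum.neutral)
      finally show ?thesis .
    qed
    then show ?thesis
      by (simp add: kraus_family_def vec_eq_iff)
  qed
  ultimately show ?thesis by blast
qed

subsection \<open>Ampliations and relabelled tensor factors\<close>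

lemma matrix_sum_right: "A ** (\<Sum>k\<in>I. M k) = (\<Sum>k\<in>I. A ** M k)"
  by (induction I rule: infinite_finite_induct) (simp_all add: matrix_add_ldistrib)

lemma matrix_sum_left: "(\<Sum>k\<in>I. M k) ** A = (\<Sum>k\<in>I. M k ** A)"
  by (simp add: matrix_matrix_mult_def vec_eq_iff sum_distrib_right) (intro allI sum.swap)

definition perm_mat :: "('k \<Rightarrow> 'n) \<Rightarrow> complex ^ 'n ^ 'k" where
  "perm_mat f = (\<chi> i j. if j = f i then 1 else 0)"

definition ampl :: "complex ^ 'm::finite ^ 'n::finite \<Rightarrow> complex ^ ('m \<times> 'k::finite) ^ ('n \<times> 'k)" where
  "ampl K = (\<chi> x y. if snd x = snd y then K $ fst x $ fst y else 0)"

lemma perm_mat_vec: "(perm_mat f *v v) $ i = v $ f i"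
  by (simp add: perm_mat_def matrix_vector_mult_def mult_delta_left)

lemma perm_mat_isometry:
  assumes "bij f" shows "adj (perm_mat f) ** perm_mat f = mat 1"
proof -
  have "(\<Sum>i\<in>UNIV. (if a = f i then 1 else 0) * (if b = f i then 1 else 0)) =
      (if a = b then 1 else (0::complex))" for a b
    using sum.reindex_bij_betw[OF assms, of "\<lambda>x. (if a = x then 1 else 0) * (if b = x then 1 else (0::complex))"]
    by (simp add: mult_delta_left)
  then show ?thesis
    by (simp add: vec_eq_iff matrix_matrix_mult_def adj_def perm_mat_def mat_def if_distrib[of cnj] cong: if_cong)
qed

lemma ampl_vec: "(ampl K *v v) $ (p, s) = (K *v (\<chi> q. v $ (q, s))) $ p"
  by (simp add: ampl_def matrix_vector_mult_def sum_UNIV_prod mult_delta_left)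

lemma ampl_mult: "ampl A ** ampl B = ampl (A ** B)"
  by (simp add: vec_eq_iff ampl_def matrix_matrix_mult_def sum_UNIV_prod mult_delta_left)

lemma adj_ampl: "adj (ampl K) = ampl (adj K)"
  by (auto simp: ampl_def adj_def vec_eq_iff)

lemma ampl_mat_1: "ampl (mat 1) = mat 1"
  by (auto simp: ampl_def mat_def vec_eq_iff)

lemma ampl_add: "ampl (A + B) = ampl A + ampl B"
  by (auto simp: ampl_def vec_eq_iff)

lemma ampl_sum: "ampl (\<Sum>k\<in>I. A k) = (\<Sum>k\<in>I. ampl (A k))"
proof (induction I rule: infinite_finite_induct)
  case (insert x F)
  then show ?case by (simp add: ampl_add)
qed (simp_all add: ampl_def vec_eq_iff)

lemma kraus_family_ampl: "kraus_family K \<Longrightarrow> kraus_family (\<lambda>k. ampl (K k))"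
  by (simp add: kraus_family_def adj_ampl ampl_mult ampl_mat_1 flip: ampl_sum)

lemma kraus_family_isometry:
  assumes "kraus_family K" "adj V ** V = mat 1"
  shows "kraus_family (\<lambda>k. V ** K k)"
proof -
  have "adj (V ** K k) ** (V ** K k) = adj (K k) ** (adj V ** V) ** K k" for k
    by (simp only: adj_mult matrix_mul_assoc)
  then show ?thesis
    using assms by (simp add: kraus_family_def)
qed

lemma kraus_family_comp:
  assumes "kraus_family K" "kraus_family L"
  shows "kraus_family (\<lambda>(k, l). L l ** K k)"
proof -
  have "(\<Sum>l\<in>UNIV. adj (L l ** K k) ** (L l ** K k)) = adj (K k) ** (\<Sum>l\<in>UNIV. adj (L l) ** L l) ** K k" for k
    by (simp add: adj_mult matrix_sum_left matrix_sum_right matrix_mul_assoc)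
  then show ?thesis
    using assms by (simp add: kraus_family_def sum_UNIV_prod)
qed

lemma on_fst_kraus:
  assumes "\<And>X. T X = (\<Sum>k\<in>UNIV. K k ** X ** adj (K k))"
  shows "on_fst T M = (\<Sum>k\<in>UNIV. ampl (K k) ** M ** adj (ampl (K k)))"
proof -
  have "on_fst T M $ (p, s) $ (q, t) = (\<Sum>k\<in>UNIV. ampl (K k) ** M ** adj (ampl (K k))) $ (p, s) $ (q, t)" for p s q t
    by (simp add: on_fst_def assms ampl_def adj_def matrix_matrix_mult_def sum_UNIV_prod
        mult_delta_left mult_delta_right if_distrib[of cnj] cong: if_cong)
  then show ?thesis by (simp add: vec_eq_iff)
qed

lemma reindex_perm: "reindex f M = perm_mat f ** M ** adj (perm_mat f)"
  by (simp add: vec_eq_iff reindex_def perm_mat_def adj_def matrix_matrix_mult_def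
      mult_delta_left mult_delta_right if_distrib[of cnj] cong: if_cong)

section \<open>Rank-one operators and the target vector\<close>

lemma ketbra_conj: "A ** ketbra v ** adj A = ketbra (A *v v)"
  by (simp add: vec_eq_iff ketbra_def adj_def matrix_matrix_mult_def matrix_vector_mult_def
      sum_distrib_left sum_distrib_right mult_ac)

lemma ketbra_vec: "ketbra u *v v = cdot u v *s u"
  by (simp add: vec_eq_iff ketbra_def matrix_vector_mult_def cdot_def sum_distrib_left mult_ac)

text \<open>Makes the projector onto the target an admissible test operator in
  \<open>trace_norm_ge\<close>.\<close>

lemma contraction_ketbra:
  assumes "norm u \<le> 1" shows "contraction (ketbra u)"
  unfolding contraction_def ketbra_vec norm_scale_vec
proof
  fix v
  have "cmod (cdot u v) * norm u \<le> (norm u * norm v) * 1"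
    using assms by (intro mult_mono cdot_Cauchy_Schwarz) auto
  also have "\<dots> \<le> 1 * norm v"
    using assms by (simp add: mult_left_le_one_le)
  finally show "cmod (cdot u v) * norm u \<le> norm v" by simp
qed

lemma trace_ketbra_mult: "trace (ketbra u ** M) = cdot u (M *v u)"
  by (simp add: trace_def ketbra_def matrix_matrix_mult_def matrix_vector_mult_def cdot_def
      sum_distrib_left mult_ac) (rule sum.swap)

lemma cdot_ketbra: "cdot v (ketbra u *v v) = of_real ((cmod (cdot v u))\<^sup>2)"
  unfolding complex_norm_square
  by (simp add: ketbra_vec cdot_scale_right cdot_commute[of u v] mult.commute)

definition Bell_vec :: "complex ^ ('k::finite \<times> 'k)" where
  "Bell_vec = (\<chi> i. if fst i = snd i then complex_of_real (1 / sqrt (real CARD('k))) else 0)"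

definition target_vec :: "complex ^ 'n::finite \<Rightarrow> complex ^ (('k::finite \<times> 'k) \<times> 'n)" where
  "target_vec \<psi> = (\<chi> x. Bell_vec $ fst x * \<psi> $ snd x)"

lemma tensor_max_entangled: "tensor max_entangled (ketbra \<psi>) = ketbra (target_vec \<psi>)"
  by (simp add: vec_eq_iff tensor_def max_entangled_def ketbra_def target_vec_def
      flip: Bell_vec_def)

lemma norm_target_vec: "norm (target_vec \<psi> :: complex ^ (('k::finite \<times> 'k) \<times> 'n::finite)) = norm \<psi>"
proof -
  have "(\<Sum>x\<in>UNIV. (cmod ((Bell_vec :: complex ^ ('k \<times> 'k)) $ x))\<^sup>2) =
      (\<Sum>a\<in>(UNIV :: 'k set). \<Sum>b\<in>UNIV. if a = b then 1 / real CARD('k) else 0)"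
    unfolding sum_UNIV_prod
    by (intro sum.cong refl) (simp add: Bell_vec_def power_divide norm_divide)
  also have "\<dots> = 1" by simp
  finally have B: "(\<Sum>x\<in>UNIV. (cmod ((Bell_vec :: complex ^ ('k \<times> 'k)) $ x))\<^sup>2) = 1" .
  have "(norm (target_vec \<psi> :: complex ^ (('k \<times> 'k) \<times> 'n)))\<^sup>2 =
     (\<Sum>x\<in>UNIV. (cmod ((Bell_vec :: complex ^ ('k \<times> 'k)) $ x))\<^sup>2) * (norm \<psi>)\<^sup>2"
    by (simp add: norm_square_sum sum_product target_vec_def norm_mult power_mult_distrib
        sum_UNIV_prod[where 'a = "'k \<times> 'k"])
  then show ?thesis by (simp add: B)
qed

subsection \<open>Kraus operators of the protocol\<close>

(* Reshapings of a tensor into a matrix across the cuts A|S, AR|B and R|AB.  With M the reshaping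
   of psi, the matrix M ** adj M is the reduced state on the first side of the cut. *)
definition amat :: "complex ^ ('a::finite \<times> 's::finite) \<Rightarrow> complex ^ 's ^ 'a" where
  "amat v = (\<chi> a s. v $ (a, s))"

definition armat :: "complex ^ ('a::finite \<times> 'b::finite \<times> 'r::finite) \<Rightarrow> complex ^ 'b ^ ('a \<times> 'r)" where
  "armat v = (\<chi> x b. v $ (fst x, b, snd x))"

definition rmat :: "complex ^ ('a::finite \<times> 'b::finite \<times> 'r::finite) \<Rightarrow> complex ^ ('a \<times> 'b) ^ 'r" where
  "rmat v = (\<chi> r x. v $ (fst x, snd x, r))"

lemma reduced_A_gram: "reduced_A v = amat v ** adj (amat v)"
  by (simp add: reduced_A_def ptrace_snd_def ketbra_def amat_def adj_def matrix_matrix_mult_def vec_eq_iff)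

lemma reduced_AR_gram: "reduced_AR v = armat v ** adj (armat v)"
  by (simp add: reduced_AR_def ptrace_snd_def ketbra_def armat_def adj_def matrix_matrix_mult_def
      vec_eq_iff reindex_def)

lemma trace_amat: "trace (adj (amat u) ** amat v) = cdot u v"
  by (simp add: trace_def adj_def amat_def matrix_matrix_mult_def cdot_def sum_UNIV_prod) (rule sum.swap)

lemma trace_armat: "trace (adj (armat u) ** armat v) = cdot u v"
  by (simp add: trace_def adj_def armat_def matrix_matrix_mult_def cdot_def sum_UNIV_prod)
    (rule sum.swap)

lemma trace_rmat: "trace (rmat u ** adj (rmat v)) = cdot v u"
  by (simp add: trace_def adj_def rmat_def matrix_matrix_mult_def cdot_def sum_UNIV_prod mult.commute)
    (subst sum.swap, intro sum.cong refl, rule sum.swap)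

definition fqsw_kraus ::
  "('k::finite \<Rightarrow> complex ^ 'a::finite ^ ('a1::finite \<times> 'a2::finite)) \<Rightarrow>
   ('l::finite \<Rightarrow> complex ^ ('a2 \<times> 'b::finite) ^ ('a1 \<times> 'a \<times> 'b)) \<Rightarrow>
   'k \<times> 'l \<Rightarrow> complex ^ ('a \<times> 'b \<times> 'r::finite) ^ (('a1 \<times> 'a1) \<times> ('a \<times> 'b \<times> 'r))" where
  "fqsw_kraus E D = (\<lambda>(k, l).
     perm_mat (\<lambda>((a1, b1), (a, b, r)). ((b1, a, b), (a1, r))) ** ampl (D l) **
     (perm_mat (\<lambda>((a2, b), (a1, r)). ((a1, a2), (b, r))) ** ampl (E k)))"

lemma fqsw_final_state_kraus:
  assumes "\<And>X. enc X = (\<Sum>k\<in>UNIV. E k ** X ** adj (E k))"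
    and "\<And>X. dec X = (\<Sum>l\<in>UNIV. D l ** X ** adj (D l))"
  shows "fqsw_final_state \<psi> enc dec = (\<Sum>x\<in>UNIV. ketbra (fqsw_kraus E D x *v \<psi>))"
  unfolding fqsw_final_state_def sum_UNIV_prod fqsw_kraus_def
  by (simp add: reindex_perm on_fst_kraus[OF assms(1)] on_fst_kraus[OF assms(2)] matrix_sum_left
      matrix_sum_right ketbra_conj matrix_vector_mul_assoc matrix_mul_assoc) (rule sum.swap)

lemma kraus_family_fqsw_kraus:
  assumes "kraus_family E" "kraus_family D"
  shows "kraus_family (fqsw_kraus E D)"
proof -
  have "bij (\<lambda>((a1::'x1, b1::'x2), (a::'x3, b::'x4, r::'x5)). ((b1, a, b), (a1, r)))"
    by (rule bijI') auto
  moreover have "bij (\<lambda>((a2::'x1, b::'x2), (a1::'x3, r::'x4)). ((a1, a2), (b, r)))"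
    by (rule bijI') auto
  ultimately show ?thesis
    unfolding fqsw_kraus_def using assms
    by (intro kraus_family_comp kraus_family_isometry kraus_family_ampl perm_mat_isometry)
qed

lemma fqsw_kraus_vec:
  "(fqsw_kraus E D (k, l) *v v) $ ((a1, b1), (a, b, r)) =
   (\<Sum>a2\<in>UNIV. \<Sum>b'\<in>UNIV. D l $ (b1, a, b) $ (a2, b') * (E k *v (\<chi> q. v $ (q, b', r))) $ (a1, a2))"
  by (simp add: fqsw_kraus_def perm_mat_vec ampl_vec flip: matrix_vector_mul_assoc)
    (simp add: matrix_vector_mult_def[of "D l"] sum_UNIV_prod ampl_vec)

subsection \<open>Overlaps with the target state\<close>

text \<open>Row i is the functional <phi|K_i. As a map it runs the protocol and projects the output
  onto phi, keeping the environment; its adjoint runs the protocol backwards from phi and an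
  environment vector.\<close>

definition overlap_mat :: "('i::finite \<Rightarrow> complex ^ 'n::finite ^ 'm::finite) \<Rightarrow> complex ^ 'm \<Rightarrow> complex ^ 'n ^ 'i" where
  "overlap_mat K \<phi> = (\<chi> i j. \<Sum>p\<in>UNIV. cnj (\<phi> $ p) * K i $ p $ j)"

lemma overlap_mat_vec: "(overlap_mat K \<phi> *v v) $ i = cdot \<phi> (K i *v v)"
  by (simp add: overlap_mat_def matrix_vector_mult_def cdot_def sum_distrib_left sum_distrib_right mult.assoc)
    (rule sum.swap)

lemma contraction_overlap_mat:
  assumes "kraus_family K" "norm \<phi> \<le> 1"
  shows "contraction (overlap_mat K \<phi>)"
  unfolding contraction_def
proof
  fix v
  have "(norm (overlap_mat K \<phi> *v v))\<^sup>2 \<le> (\<Sum>i\<in>UNIV. (norm (K i *v v))\<^sup>2)"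
    unfolding norm_square_sum[of "overlap_mat K \<phi> *v v"]
  proof (intro sum_mono power_mono)
    fix i
    have "cmod (cdot \<phi> (K i *v v)) \<le> norm \<phi> * norm (K i *v v)"
      by (rule cdot_Cauchy_Schwarz)
    also have "\<dots> \<le> 1 * norm (K i *v v)"
      using assms(2) by (intro mult_right_mono) auto
    finally show "cmod ((overlap_mat K \<phi> *v v) $ i) \<le> norm (K i *v v)"
      by (simp add: overlap_mat_vec)
  qed simp
  also have "\<dots> = (norm v)\<^sup>2"
    by (rule kraus_family_norm[OF assms(1)])
  finally show "norm (overlap_mat K \<phi> *v v) \<le> norm v"
    by (rule power2_le_imp_le) simp
qed

text \<open>Applied to a sum over A2, this is the source of the factor \<open>CARD('a2)\<close> in
  the marginal bound.\<close>

lemma cmod_sum_squared_le: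
  fixes f :: "'i::finite \<Rightarrow> complex"
  shows "(cmod (\<Sum>i\<in>UNIV. f i))\<^sup>2 \<le> real CARD('i) * (\<Sum>i\<in>UNIV. (cmod (f i))\<^sup>2)"
proof -
  have "(cmod (\<Sum>i\<in>UNIV. f i))\<^sup>2 \<le> (\<Sum>i\<in>UNIV. cmod (f i))\<^sup>2"
    by (intro power_mono norm_sum norm_ge_zero)
  also have "\<dots> \<le> real CARD('i) * (\<Sum>i\<in>UNIV. (cmod (f i))\<^sup>2)"
    using sum_squared_le_sum_of_squares[of "\<lambda>i. cmod (f i)" "UNIV :: 'i set"] by (simp add: mult.commute)
  finally show ?thesis .
qed

text \<open>The product of x with the basis vector b. The AR-marginal of t has at x the quadratic
  form given by the sum over b of the squared overlaps of t with these vectors.\<close>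

definition insert_B :: "'b \<Rightarrow> complex ^ ('a::finite \<times> 'r::finite) \<Rightarrow> complex ^ ('a \<times> 'b::finite \<times> 'r)" where
  "insert_B b x = (\<chi> y. if fst (snd y) = b then x $ (fst y, snd (snd y)) else 0)"

lemma adj_armat_vec: "(adj (armat t) *v x) $ b = cdot t (insert_B b x)"
  by (simp add: adj_def armat_def insert_B_def matrix_vector_mult_def cdot_def sum_UNIV_prod
      mult_delta_right if_distrib[of "(*) _"] cong: if_cong)
    (subst sum.swap, simp)

lemma sum_sum_delta:
  "(\<Sum>a\<in>UNIV. \<Sum>b\<in>I. if c = a then f a b else 0) = (\<Sum>b\<in>I. f c b)"
  for f :: "'a::finite \<Rightarrow> 'b \<Rightarrow> 'c::comm_monoid_add"
  by (subst sum.swap) simp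

lemma cdot_tensor_mat_1:
  "cdot x (tensor (mat 1) (H ** adj H) *v x) =
    of_real (\<Sum>a\<in>UNIV. (norm (adj H *v (\<chi> r. x $ (a, r))))\<^sup>2)"
proof -
  have "cdot x (tensor (mat 1) S *v x) = (\<Sum>a\<in>UNIV. cdot (\<chi> r. x $ (a, r)) (S *v (\<chi> r. x $ (a, r))))" for S
    by (simp add: cdot_def matrix_vector_mult_def sum_UNIV_prod tensor_def mat_def mult_delta_left
        sum_sum_delta)
  then show ?thesis
    by (simp add: cdot_gram)
qed

text \<open>The coordinates y are those of the copy of AB in psi, and R is contracted between psi
  and x. The squared norms of these vectors of A sum up to the form of I (x) psi^R at x, and they
  are what the encoder receives once the target is paired with the output.\<close>

definition R_slice :: "complex ^ ('a::finite \<times> 'b::finite \<times> 'r::finite) \<Rightarrow> complex ^ ('a \<times> 'r) \<Rightarrow>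
    'a \<times> 'b \<Rightarrow> complex ^ 'a" where
  "R_slice \<psi> x y = (\<chi> a. \<Sum>r\<in>UNIV. cnj (\<psi> $ (fst y, snd y, r)) * x $ (a, r))"

lemma cdot_tensor_mat_1_rmat:
  "cdot x (tensor (mat 1) (rmat \<psi> ** adj (rmat \<psi>)) *v x) =
    of_real (\<Sum>y\<in>UNIV. (norm (R_slice \<psi> x y))\<^sup>2)"
proof -
  have "(adj (rmat \<psi>) *v (\<chi> r. x $ (a, r))) $ y = R_slice \<psi> x y $ a" for a y
    by (simp add: adj_def rmat_def matrix_vector_mult_def R_slice_def)
  then have "(\<Sum>a\<in>UNIV. (norm (adj (rmat \<psi>) *v (\<chi> r. x $ (a, r))))\<^sup>2) =
      (\<Sum>y\<in>UNIV. (norm (R_slice \<psi> x y))\<^sup>2)"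
    unfolding norm_square_sum by simp (rule sum.swap)
  then show ?thesis
    by (simp only: cdot_tensor_mat_1)
qed

text \<open>The diagonal of the Bell vector identifies Alice's half a1 with the decoded half, which
  is \<open>fst p\<close>, and contributes the normalization. The remaining output
  \<open>snd p\<close> is paired with psi, whose R-part meets that of x and forms
  \<open>R_slice\<close>.\<close>

lemma target_overlap_insert_B:
  fixes E :: "'k::finite \<Rightarrow> complex ^ 'a::finite ^ ('a1::finite \<times> 'a2::finite)"
    and D :: "'l::finite \<Rightarrow> complex ^ ('a2 \<times> 'b::finite) ^ ('a1 \<times> 'a \<times> 'b)"
    and x :: "complex ^ ('a \<times> 'r::finite)"
  shows "cdot (target_vec \<psi>) (fqsw_kraus E D (k, l) *v insert_B b x) =
    of_real (1 / sqrt (real CARD('a1))) *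
      (\<Sum>a2\<in>UNIV. \<Sum>p\<in>UNIV. D l $ p $ (a2, b) * (E k *v R_slice \<psi> x (snd p)) $ (fst p, a2))"
proof -
  define c :: complex where "c = of_real (1 / sqrt (real CARD('a1)))"
  have ins: "(\<chi> q. insert_B b x $ (q, b', r)) = (if b' = b then \<chi> q. x $ (q, r) else 0)" for b' r
    by (simp add: insert_B_def vec_eq_iff)
  have K: "(fqsw_kraus E D (k, l) *v insert_B b x) $ ((a1, b1), (a, b', r)) =
      (\<Sum>a2\<in>UNIV. D l $ (b1, a, b') $ (a2, b) * (E k *v (\<chi> q. x $ (q, r))) $ (a1, a2))" for a1 b1 a b' r
    unfolding fqsw_kraus_vec ins
    by (simp add: if_distrib[of "\<lambda>u. (E k *v u) $ _"] if_distrib[of "(*) _"] cong: if_cong)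
  \<comment> \<open>R is untouched by the encoder, so the contraction with psi passes through
    E.\<close>
  have S: "(\<Sum>r\<in>UNIV. cnj (\<psi> $ (a, b', r)) * (E k *v (\<chi> q. x $ (q, r))) $ y) =
      (E k *v R_slice \<psi> x (a, b')) $ y" for a b' y
    by (simp add: matrix_vector_mult_def R_slice_def sum_distrib_left mult_ac) (rule sum.swap)
  have "cdot (target_vec \<psi>) (fqsw_kraus E D (k, l) *v insert_B b x) =
    (\<Sum>a1\<in>UNIV. \<Sum>b1\<in>UNIV. \<Sum>a\<in>UNIV. \<Sum>b'\<in>UNIV. \<Sum>r\<in>UNIV.
      (if a1 = b1 then c else 0) * cnj (\<psi> $ (a, b', r)) *
       (\<Sum>a2\<in>UNIV. D l $ (b1, a, b') $ (a2, b) * (E k *v (\<chi> q. x $ (q, r))) $ (a1, a2)))"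
    by (simp add: cdot_def sum_UNIV_prod K target_vec_def Bell_vec_def c_def
        if_distrib[of cnj] cong: if_cong)
  also have "\<dots> = (\<Sum>a1\<in>UNIV. \<Sum>b1\<in>UNIV. if a1 = b1 then
     (\<Sum>a\<in>UNIV. \<Sum>b'\<in>UNIV. \<Sum>r\<in>UNIV. c * cnj (\<psi> $ (a, b', r)) *
       (\<Sum>a2\<in>UNIV. D l $ (b1, a, b') $ (a2, b) * (E k *v (\<chi> q. x $ (q, r))) $ (b1, a2))) else 0)"
    by (intro sum.cong refl) auto
  also have "\<dots> = (\<Sum>b1\<in>UNIV. \<Sum>a\<in>UNIV. \<Sum>b'\<in>UNIV. \<Sum>r\<in>UNIV. \<Sum>a2\<in>UNIV.
       c * (D l $ (b1, a, b') $ (a2, b) * (cnj (\<psi> $ (a, b', r)) * (E k *v (\<chi> q. x $ (q, r))) $ (b1, a2))))"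
    by (simp add: sum_distrib_left mult_ac)
  also have "\<dots> = (\<Sum>b1\<in>UNIV. \<Sum>a\<in>UNIV. \<Sum>b'\<in>UNIV. \<Sum>a2\<in>UNIV. 
       c * (D l $ (b1, a, b') $ (a2, b) * (E k *v R_slice \<psi> x (a, b')) $ (b1, a2)))"
    unfolding S[symmetric] sum_distrib_left by (intro sum.cong refl sum.swap)
  also have "\<dots> = (\<Sum>p\<in>UNIV. \<Sum>a2\<in>UNIV.
      c * (D l $ p $ (a2, b) * (E k *v R_slice \<psi> x (snd p)) $ (fst p, a2)))"
    by (simp add: sum_UNIV_prod)
  also have "\<dots> = c * (\<Sum>a2\<in>UNIV. \<Sum>p\<in>UNIV. D l $ p $ (a2, b) * (E k *v R_slice \<psi> x (snd p)) $ (fst p, a2))"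
    by (subst sum.swap) (simp add: sum_distrib_left)
  finally show ?thesis by (simp add: c_def)
qed

subsection \<open>Operator bounds on the marginals\<close>

text \<open>The hypothesis on w says that its marginal on the encoder's environment is at most
  \<kappa> I. At x, the sum over b and l is controlled by contractivity of the adjoint decoder, the
  sum over a2 by Cauchy-Schwarz, and the sum over k by \<kappa>; the encoder then preserves the
  norms of the \<open>R_slice\<close> vectors. The factor 1 / \<open>CARD('a1)\<close> is the
  squared Bell amplitude.\<close>

lemma reduced_AR_overlap_bound:
  fixes E :: "'k::finite \<Rightarrow> complex ^ 'a::finite ^ ('a1::finite \<times> 'a2::finite)"
    and D :: "'l::finite \<Rightarrow> complex ^ ('a2 \<times> 'b::finite) ^ ('a1 \<times> 'a \<times> 'b)"
    and \<psi> :: "complex ^ ('a \<times> 'b \<times> 'r::finite)"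
    and w :: "complex ^ ('k \<times> 'l)"
  assumes E: "kraus_family E" and D: "kraus_family D"
    and w: "\<And>\<zeta>. (\<Sum>l\<in>UNIV. (cmod (\<Sum>k\<in>UNIV. cnj (w $ (k, l)) * \<zeta> k))\<^sup>2) \<le> \<kappa> * (\<Sum>k\<in>UNIV. (cmod (\<zeta> k))\<^sup>2)"
  defines "t \<equiv> adj (overlap_mat (fqsw_kraus E D) (target_vec \<psi>)) *v w"
  shows "psd ((\<kappa> * real CARD('a2) / real CARD('a1)) *\<^sub>R tensor (mat 1) (rmat \<psi> ** adj (rmat \<psi>)) - reduced_AR t)"
proof -
  define d where "d = real CARD('a1)"
  define c :: complex where "c = of_real (1 / sqrt d)"
  have d: "d > 0" by (simp add: d_def)
  have c2: "(cmod c)\<^sup>2 = 1 / d"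
    using d by (simp add: c_def norm_divide power_divide)
  have main: "(norm (adj (armat t) *v x))\<^sup>2 \<le> \<kappa> * real CARD('a2) / d * (\<Sum>y\<in>UNIV. (norm (R_slice \<psi> x y))\<^sup>2)" for x
  proof -
    \<comment> \<open>u is the amplitude of the encoder branch k, s sums k out against w, and q
      feeds the conjugate of s to the adjoint decoder for a fixed sent value a2. The value of q has
      an A2-coordinate of its own, which is read at the same a2.\<close>
    define u where "u k a2 p = (E k *v R_slice \<psi> x (snd p)) $ (fst p, a2)" for k a2 and p :: "'a1 \<times> 'a \<times> 'b"
    define s where "s l a2 p = (\<Sum>k\<in>UNIV. cnj (w $ (k, l)) * u k a2 p)" for l a2 p
    define q where "q a2 = (\<Sum>l\<in>UNIV. adj (D l) *v (\<chi> p. cnj (s l a2 p)))" for a2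
    have "(adj (armat t) *v x) $ b = c * (\<Sum>a2\<in>UNIV. cnj (q a2 $ (a2, b)))" for b
    proof -
      have "(adj (armat t) *v x) $ b = cdot w (overlap_mat (fqsw_kraus E D) (target_vec \<psi>) *v insert_B b x)"
        by (simp add: adj_armat_vec t_def cdot_adj)
      also have "\<dots> = (\<Sum>k\<in>UNIV. \<Sum>l\<in>UNIV. cnj (w $ (k, l)) *
          (c * (\<Sum>a2\<in>UNIV. \<Sum>p\<in>UNIV. D l $ p $ (a2, b) * u k a2 p)))"
        by (simp add: cdot_def[of w] sum_UNIV_prod[where 'a = 'k] overlap_mat_vec target_overlap_insert_B u_def c_def d_def)
      also have "\<dots> = (\<Sum>k\<in>UNIV. \<Sum>l\<in>UNIV. \<Sum>a2\<in>UNIV. \<Sum>p\<in>UNIV.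
          c * (D l $ p $ (a2, b) * (cnj (w $ (k, l)) * u k a2 p)))"
        by (simp add: sum_distrib_left mult_ac)
      also have "\<dots> = (\<Sum>l\<in>UNIV. \<Sum>a2\<in>UNIV. \<Sum>p\<in>UNIV. \<Sum>k\<in>UNIV.
          c * (D l $ p $ (a2, b) * (cnj (w $ (k, l)) * u k a2 p)))"
        by (subst sum.swap, intro sum.cong refl, subst sum.swap, intro sum.cong refl, rule sum.swap)
      also have "\<dots> = (\<Sum>a2\<in>UNIV. \<Sum>l\<in>UNIV. \<Sum>p\<in>UNIV. c * (D l $ p $ (a2, b) * s l a2 p))"
        by (subst sum.swap) (simp add: s_def sum_distrib_left)
      also have "\<dots> = c * (\<Sum>a2\<in>UNIV. \<Sum>l\<in>UNIV. \<Sum>p\<in>UNIV. D l $ p $ (a2, b) * s l a2 p)"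
        by (simp add: sum_distrib_left)
      also have "(\<Sum>a2\<in>UNIV. \<Sum>l\<in>UNIV. \<Sum>p\<in>UNIV. D l $ p $ (a2, b) * s l a2 p) =
          (\<Sum>a2\<in>UNIV. cnj (q a2 $ (a2, b)))"
        by (simp add: q_def adj_def matrix_vector_mult_def)
      finally show ?thesis .
    qed
    then have "(norm (adj (armat t) *v x))\<^sup>2 =
        (\<Sum>b\<in>UNIV. (cmod c)\<^sup>2 * (cmod (\<Sum>a2\<in>UNIV. cnj (q a2 $ (a2, b))))\<^sup>2)"
      by (simp add: norm_square_sum[of "adj _ *v _"] norm_mult power_mult_distrib)
    also have "\<dots> \<le> (\<Sum>b\<in>UNIV. (cmod c)\<^sup>2 * (real CARD('a2) * (\<Sum>a2\<in>UNIV. (cmod (cnj (q a2 $ (a2, b))))\<^sup>2)))"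
      by (intro sum_mono mult_left_mono cmod_sum_squared_le) simp
    also have "\<dots> = (real CARD('a2) / d) * (\<Sum>a2\<in>UNIV. \<Sum>b\<in>UNIV. (cmod (q a2 $ (a2, b)))\<^sup>2)"
      unfolding c2 by (subst sum.swap) (simp add: sum_distrib_left)
    also have "\<dots> \<le> (real CARD('a2) / d) * (\<Sum>a2\<in>UNIV. \<Sum>p\<in>UNIV. \<kappa> * (\<Sum>k\<in>UNIV. (cmod (u k a2 p))\<^sup>2))"
    proof (intro mult_left_mono sum_mono)
      fix a2
      \<comment> \<open>Only the slice of q a2 at the coordinate a2 occurs; it is enlarged to the
        whole vector so that the norm bound for the adjoint decoder applies.\<close>
      have "(\<Sum>b\<in>UNIV. (cmod (q a2 $ (a2, b)))\<^sup>2) \<le> (\<Sum>a\<in>UNIV. \<Sum>b\<in>UNIV. (cmod (q a2 $ (a, b)))\<^sup>2)"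
        by (rule member_le_sum) (auto intro: sum_nonneg)
      also have "\<dots> = (norm (q a2))\<^sup>2"
        by (simp add: norm_square_sum sum_UNIV_prod)
      also have "\<dots> \<le> (\<Sum>l\<in>UNIV. (norm (\<chi> p. cnj (s l a2 p)))\<^sup>2)"
        unfolding q_def by (rule kraus_family_adj_norm[OF D])
      also have "\<dots> = (\<Sum>p\<in>UNIV. \<Sum>l\<in>UNIV. (cmod (s l a2 p))\<^sup>2)"
        unfolding norm_square_sum by (subst sum.swap) simp
      also have "\<dots> \<le> (\<Sum>p\<in>UNIV. \<kappa> * (\<Sum>k\<in>UNIV. (cmod (u k a2 p))\<^sup>2))"
        unfolding s_def by (intro sum_mono w)
      finally show "(\<Sum>b\<in>UNIV. (cmod (q a2 $ (a2, b)))\<^sup>2) \<le> (\<Sum>p\<in>UNIV. \<kappa> * (\<Sum>k\<in>UNIV. (cmod (u k a2 p))\<^sup>2))" .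
    qed (use d in simp)
    also have "\<dots> = \<kappa> * real CARD('a2) / d * (\<Sum>a2\<in>UNIV. \<Sum>p\<in>UNIV. \<Sum>k\<in>UNIV. (cmod (u k a2 p))\<^sup>2)"
      by (simp add: sum_distrib_left mult_ac)
    also have "(\<Sum>a2\<in>UNIV. \<Sum>p\<in>UNIV. \<Sum>k\<in>UNIV. (cmod (u k a2 p))\<^sup>2) =
        (\<Sum>y\<in>UNIV. \<Sum>k\<in>UNIV. \<Sum>a1\<in>UNIV. \<Sum>a2\<in>UNIV. (cmod ((E k *v R_slice \<psi> x y) $ (a1, a2)))\<^sup>2)"
      (is "?L = ?R")
    proof -
      have "?L = (\<Sum>a2\<in>UNIV. \<Sum>a1\<in>UNIV. \<Sum>y\<in>UNIV. \<Sum>k\<in>UNIV. (cmod ((E k *v R_slice \<psi> x y) $ (a1, a2)))\<^sup>2)"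
        by (simp add: sum_UNIV_prod[where 'a = 'a1] u_def)
      also have "\<dots> = (\<Sum>a1\<in>UNIV. \<Sum>y\<in>UNIV. \<Sum>k\<in>UNIV. \<Sum>a2\<in>UNIV. (cmod ((E k *v R_slice \<psi> x y) $ (a1, a2)))\<^sup>2)"
        by (subst sum.swap, intro sum.cong refl, subst sum.swap, intro sum.cong refl, rule sum.swap)
      also have "\<dots> = ?R"
        by (subst sum.swap, intro sum.cong refl, rule sum.swap)
      finally show ?thesis .
    qed
    also have "\<dots> = (\<Sum>y\<in>UNIV. \<Sum>k\<in>UNIV. (norm (E k *v R_slice \<psi> x y))\<^sup>2)"
      by (simp add: norm_square_sum sum_UNIV_prod[where 'a = 'a1])
    also have "\<dots> = (\<Sum>y\<in>UNIV. (norm (R_slice \<psi> x y))\<^sup>2)"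
      by (simp only: kraus_family_norm[OF E])
    finally show ?thesis .
  qed
  show ?thesis
    unfolding psd_def
  proof
    fix x
    let ?T = "tensor (mat 1) (rmat \<psi> ** adj (rmat \<psi>)) :: ('a \<times> 'r) op"
    let ?c = "\<kappa> * real CARD('a2) / real CARD('a1)"
    have sc: "cdot x ((?c *\<^sub>R ?T) *v x) = of_real ?c * cdot x (?T *v x)"
      by (simp add: cdot_def matrix_vector_mult_def sum_distrib_left scaleR_conv_of_real[where 'a = complex] mult_ac)
    show "cdot x ((?c *\<^sub>R ?T - reduced_AR t) *v x) \<in> \<real>\<^sub>\<ge>\<^sub>0"
      unfolding matrix_vector_mult_diff_rdistrib cdot_diff_right sc
        cdot_tensor_mat_1_rmat reduced_AR_gram cdot_gram
      using main[of x] by (simp add: d_def nonneg_Reals_iff del: of_real_sum of_real_mult of_real_power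
          flip: of_real_mult of_real_diff)
  qed
qed

text \<open>The case \<kappa> = 1: a marginal of a vector of norm at most 1 is at most the identity,
  by Cauchy-Schwarz in k for each l.\<close>

lemma overlap_gram_bound_norm:
  fixes w :: "complex ^ ('k::finite \<times> 'l::finite)"
  assumes "norm w \<le> 1"
  shows "(\<Sum>l\<in>UNIV. (cmod (\<Sum>k\<in>UNIV. cnj (w $ (k, l)) * \<zeta> k))\<^sup>2) \<le> (\<Sum>k\<in>UNIV. (cmod (\<zeta> k))\<^sup>2)"
proof -
  define Z where "Z = (\<Sum>k\<in>UNIV. (cmod (\<zeta> k))\<^sup>2)"
  have Z: "Z \<ge> 0" by (simp add: Z_def sum_nonneg)
  have "(\<Sum>l\<in>UNIV. (cmod (\<Sum>k\<in>UNIV. cnj (w $ (k, l)) * \<zeta> k))\<^sup>2) \<le> (\<Sum>l\<in>UNIV. (\<Sum>k\<in>UNIV. (cmod (w $ (k, l)))\<^sup>2) * Z)"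
  proof (intro sum_mono)
    fix l
    have "cmod (\<Sum>k\<in>UNIV. cnj (w $ (k, l)) * \<zeta> k) = cmod (cdot (\<chi> k. w $ (k, l)) (\<chi> k. \<zeta> k))"
      by (simp add: cdot_def)
    also have "\<dots> \<le> norm (\<chi> k. w $ (k, l)) * norm (\<chi> k. \<zeta> k)"
      by (rule cdot_Cauchy_Schwarz)
    finally have "(cmod (\<Sum>k\<in>UNIV. cnj (w $ (k, l)) * \<zeta> k))\<^sup>2 \<le> (norm (\<chi> k. w $ (k, l)))\<^sup>2 * (norm (\<chi> k. \<zeta> k))\<^sup>2"
      unfolding power_mult_distrib[symmetric] by (intro power_mono) auto
    then show "(cmod (\<Sum>k\<in>UNIV. cnj (w $ (k, l)) * \<zeta> k))\<^sup>2 \<le> (\<Sum>k\<in>UNIV. (cmod (w $ (k, l)))\<^sup>2) * Z"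
      by (simp add: norm_square_sum Z_def)
  qed
  also have "\<dots> = (norm w)\<^sup>2 * Z"
    unfolding norm_square_sum sum_UNIV_prod by (subst sum.swap) (simp add: sum_distrib_right)
  also have "\<dots> \<le> 1 * Z"
    using assms Z by (intro mult_right_mono) (auto simp: power_le_one)
  finally show ?thesis by (simp add: Z_def)
qed

text \<open>Testing w against \<zeta> on the encoder's environment is a superposition of encoder
  branches, followed by a contraction from decoder and target. Each of the |A1||A2| output
  coordinates of the encoder then sees v only through a vector of A no longer than \<zeta>, where
  the bound \<mu> on v^A applies.\<close>

lemma overlap_gram_bound_marginal:
  fixes E :: "'k::finite \<Rightarrow> complex ^ 'a::finite ^ ('a1::finite \<times> 'a2::finite)"
    and D :: "'l::finite \<Rightarrow> complex ^ ('a2 \<times> 'b::finite) ^ ('a1 \<times> 'a \<times> 'b)"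
    and \<psi> v :: "complex ^ ('a \<times> 'b \<times> 'r::finite)"
  assumes E: "kraus_family E" and D: "kraus_family D" and \<psi>: "norm \<psi> \<le> 1"
    and v: "\<And>h. (norm (adj (amat v) *v h))\<^sup>2 \<le> \<mu> * (norm h)\<^sup>2"
  defines "w \<equiv> overlap_mat (fqsw_kraus E D) (target_vec \<psi>) *v v"
  shows "(\<Sum>l\<in>UNIV. (cmod (\<Sum>k\<in>UNIV. cnj (w $ (k, l)) * \<zeta> k))\<^sup>2) \<le>
    \<mu> * (real CARD('a1) * real CARD('a2)) * (\<Sum>k\<in>UNIV. (cmod (\<zeta> k))\<^sup>2)"
proof -
  have \<mu>: "\<mu> \<ge> 0"
  proof -
    have "(0::real) \<le> \<mu> * (norm (axis undefined 1 :: complex ^ 'a))\<^sup>2"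
      by (rule order_trans[OF _ v]) simp
    then show ?thesis by (simp add: norm_axis_1)
  qed
  define P1 :: "complex ^ (('a1 \<times> 'a2) \<times> ('b \<times> 'r)) ^ (('a2 \<times> 'b) \<times> ('a1 \<times> 'r))"
    where "P1 = perm_mat (\<lambda>((a2, b), (a1, r)). ((a1, a2), (b, r)))"
  define P2 :: "complex ^ (('a1 \<times> 'a \<times> 'b) \<times> ('a1 \<times> 'r)) ^ (('a1 \<times> 'a1) \<times> ('a \<times> 'b \<times> 'r))"
    where "P2 = perm_mat (\<lambda>((a1, b1), (a, b, r)). ((b1, a, b), (a1, r)))"
  have P1: "adj P1 ** P1 = mat 1" and P2: "adj P2 ** P2 = mat 1"
    unfolding P1_def P2_def by (intro perm_mat_isometry bijI'; auto)+
  \<comment> \<open>Linearity collects all branches k in the single vector g, so that the decoder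
    can be discarded without touching the correlation between k and A.\<close>
  define g where "g = (\<Sum>k\<in>UNIV. cnj (\<zeta> k) *s (ampl (E k) *v v))"
  have fq: "fqsw_kraus E D (k, l) = P2 ** ampl (D l) ** P1 ** ampl (E k)" for k l
    by (simp add: fqsw_kraus_def P1_def P2_def matrix_mul_assoc)
  have D': "kraus_family (\<lambda>l. P2 ** ampl (D l))"
    by (intro kraus_family_isometry kraus_family_ampl D P2)
  have "(\<Sum>k\<in>UNIV. cnj (w $ (k, l)) * \<zeta> k) = cnj (cdot (target_vec \<psi>) ((P2 ** ampl (D l)) *v (P1 *v g)))" for l
    by (simp add: w_def overlap_mat_vec fq g_def matrix_vector_sum_right cdot_sum_right vector_scalar_commute
        cdot_scale_right matrix_vector_mul_assoc matrix_mul_assoc mult.commute)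
  then have "(\<Sum>l\<in>UNIV. (cmod (\<Sum>k\<in>UNIV. cnj (w $ (k, l)) * \<zeta> k))\<^sup>2) =
      (norm (overlap_mat (\<lambda>l. P2 ** ampl (D l)) (target_vec \<psi>) *v (P1 *v g)))\<^sup>2"
    by (simp add: norm_square_sum[of "overlap_mat _ _ *v _"] overlap_mat_vec)
  also have "\<dots> \<le> (norm (P1 *v g))\<^sup>2"
    using contraction_overlap_mat[OF D', of "target_vec \<psi>"] \<psi>
    by (intro power_mono) (auto simp: contraction_def norm_target_vec)
  also have "\<dots> \<le> (norm g)\<^sup>2"
    using contraction_isometry[OF P1] by (intro power_mono) (auto simp: contraction_def)
  also have "\<dots> = (\<Sum>p\<in>UNIV. \<Sum>s\<in>UNIV. (cmod (g $ (p, s)))\<^sup>2)"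
    by (simp only: norm_square_sum sum_UNIV_prod[where 'a = "'a1 \<times> 'a2"])
  also have "\<dots> \<le> (\<Sum>p\<in>(UNIV :: ('a1 \<times> 'a2) set). \<mu> * (\<Sum>k\<in>UNIV. (cmod (\<zeta> k))\<^sup>2))"
  proof (intro sum_mono)
    fix p :: "'a1 \<times> 'a2"
    \<comment> \<open>The adjoint encoder applied to the output coordinate p with environment
      \<zeta>; the slice of g at p is, up to conjugation, the matrix of v applied to h.\<close>
    define h where "h = (\<Sum>k\<in>UNIV. adj (E k) *v (\<zeta> k *s axis p 1))"
    have hc: "h $ a = (\<Sum>k\<in>UNIV. \<zeta> k * cnj (E k $ p $ a))" for a
      by (simp add: h_def vector_scalar_commute mult_axis) (simp add: adj_def)
    have "g $ (p, s) = cnj ((adj (amat v) *v h) $ s)" for s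
    proof -
      have "g $ (p, s) = (\<Sum>k\<in>UNIV. cnj (\<zeta> k) * (E k *v (\<chi> q. v $ (q, s))) $ p)"
        by (simp add: g_def ampl_vec)
      also have "\<dots> = cnj ((adj (amat v) *v h) $ s)"
        by (simp add: matrix_vector_mult_def adj_def amat_def hc sum_distrib_left mult_ac)
          (rule sum.swap)
      finally show ?thesis .
    qed
    then have "(\<Sum>s\<in>UNIV. (cmod (g $ (p, s)))\<^sup>2) = (norm (adj (amat v) *v h))\<^sup>2"
      by (simp add: norm_square_sum)
    also have "\<dots> \<le> \<mu> * (norm h)\<^sup>2"
      by (rule v)
    also have "\<dots> \<le> \<mu> * (\<Sum>k\<in>UNIV. (norm (\<zeta> k *s axis p 1))\<^sup>2)"
      unfolding h_def by (intro mult_left_mono kraus_family_adj_norm E \<mu>)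
    also have "\<dots> = \<mu> * (\<Sum>k\<in>UNIV. (cmod (\<zeta> k))\<^sup>2)"
      by (simp add: norm_scale_vec norm_axis_1)
    finally show "(\<Sum>s\<in>UNIV. (cmod (g $ (p, s)))\<^sup>2) \<le> \<mu> * (\<Sum>k\<in>UNIV. (cmod (\<zeta> k))\<^sup>2)" .
  qed
  finally show ?thesis
    by (simp add: card_prod mult_ac)
qed

subsection \<open>The converse bounds\<close>

lemma trace_norm_nonneg: "0 \<le> trace_norm X"
proof -
  have "contraction (0 :: 'a op)" by (simp add: contraction_def)
  from trace_norm_ge[OF this, of X] show ?thesis by (simp add: trace_def)
qed

text \<open>Reduces a lower bound on the smooth entropy to three witnesses: a nearby operator, a
  state on the conditioning system and a scalar.\<close>

lemma hmin_cond_smooth_ge: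
  assumes "\<rho>' \<in> smoothing_ball \<delta> \<rho>" "\<sigma> \<in> states" "psd (t *\<^sub>R tensor (mat 1) \<sigma> - \<rho>')"
  shows "- elog2 t \<le> hmin_cond_smooth \<delta> \<rho>"
proof -
  have "dmax \<rho>' (tensor (mat 1) \<sigma>) \<le> elog2 t"
    unfolding dmax_def using assms(3) by (intro INF_lower) simp
  then have "- elog2 t \<le> - dmax \<rho>' (tensor (mat 1) \<sigma>)"
    by simp
  also have "\<dots> \<le> hmin_cond \<rho>'"
    unfolding hmin_cond_def by (intro SUP_upper assms(2))
  also have "\<dots> \<le> hmin_cond_smooth \<delta> \<rho>"
    unfolding hmin_cond_smooth_def by (intro SUP_upper assms(1))
  finally show ?thesis .
qed

text \<open>Ranges over every operator of the ball and every scalar above it, so that no extremum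
  has to be attained.\<close>

lemma hmin_smooth_le:
  assumes "\<And>\<rho>' t. \<rho>' \<in> smoothing_ball \<epsilon> \<rho> \<Longrightarrow> psd (t *\<^sub>R mat 1 - \<rho>') \<Longrightarrow> - elog2 t \<le> H"
  shows "hmin_smooth \<epsilon> \<rho> \<le> H"
  unfolding hmin_smooth_def hmin_def dmax_def
proof (intro SUP_least)
  fix \<rho>' assume "\<rho>' \<in> smoothing_ball \<epsilon> \<rho>"
  then have "- H \<le> (INF t\<in>{t. psd (t *\<^sub>R mat 1 - \<rho>')}. elog2 t)"
    using assms by (intro INF_greatest) (auto simp: ereal_uminus_le_reorder)
  then show "- (INF t\<in>{t. psd (t *\<^sub>R mat 1 - \<rho>')}. elog2 t) \<le> H"
    by (simp add: ereal_uminus_le_reorder)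
qed

text \<open>Testing the difference of the states with the projector onto the pure target shows that
  the weight of the final state on the target is at least 1 - \<epsilon>. That weight is the sum
  over all Kraus branches of the squared overlaps with the target.\<close>

lemma fqsw_protocol_kraus:
  fixes \<psi> :: "complex ^ ('a::finite \<times> 'b::finite \<times> 'r::finite)"
    and enc :: "'a op \<Rightarrow> ('a1::finite \<times> 'a2::finite) op"
    and dec :: "('a2 \<times> 'b) op \<Rightarrow> ('a1 \<times> 'a \<times> 'b) op"
  assumes \<psi>: "norm \<psi> = 1" and prot: "fqsw_protocol \<epsilon> \<psi> enc dec"
  obtains E :: "'a \<times> ('a1 \<times> 'a2) \<Rightarrow> complex ^ 'a ^ ('a1 \<times> 'a2)"
    and D :: "('a2 \<times> 'b) \<times> ('a1 \<times> 'a \<times> 'b) \<Rightarrow> complex ^ ('a2 \<times> 'b) ^ ('a1 \<times> 'a \<times> 'b)"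
  where "kraus_family E" "kraus_family D"
    "1 - \<epsilon> \<le> (norm (overlap_mat (fqsw_kraus E D) (target_vec \<psi>) *v \<psi>))\<^sup>2"
proof -
  have "cptp enc" "cptp dec" and close:
    "trace_norm (tensor max_entangled (ketbra \<psi>) - fqsw_final_state \<psi> enc dec) \<le> \<epsilon>"
    using prot by (auto simp: fqsw_protocol_def)
  obtain E :: "'a \<times> ('a1 \<times> 'a2) \<Rightarrow> complex ^ 'a ^ ('a1 \<times> 'a2)"
    where E: "kraus_family E" "\<And>X. enc X = (\<Sum>k\<in>UNIV. E k ** X ** adj (E k))"
    using cptp_kraus[OF \<open>cptp enc\<close>] by blast
  obtain D :: "('a2 \<times> 'b) \<times> ('a1 \<times> 'a \<times> 'b) \<Rightarrow> complex ^ ('a2 \<times> 'b) ^ ('a1 \<times> 'a \<times> 'b)"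
    where D: "kraus_family D" "\<And>X. dec X = (\<Sum>k\<in>UNIV. D k ** X ** adj (D k))"
    using cptp_kraus[OF \<open>cptp dec\<close>] by blast
  define \<phi> :: "complex ^ (('a1 \<times> 'a1) \<times> ('a \<times> 'b \<times> 'r))" where "\<phi> = target_vec \<psi>"
  have \<phi>: "norm \<phi> = 1"
    by (simp add: \<phi>_def norm_target_vec \<psi>)
  have "trace (ketbra \<phi> ** (tensor max_entangled (ketbra \<psi>) - fqsw_final_state \<psi> enc dec)) =
      cdot \<phi> (ketbra \<phi> *v \<phi>) - (\<Sum>x\<in>UNIV. cdot \<phi> (ketbra (fqsw_kraus E D x *v \<psi>) *v \<phi>))"
    unfolding trace_ketbra_mult tensor_max_entangled fqsw_final_state_kraus[OF E(2) D(2)] \<phi>_def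
    by (simp only: matrix_vector_mult_diff_rdistrib cdot_diff_right matrix_vector_sum_left cdot_sum_right)
  also have "\<dots> = of_real (1 - (norm (overlap_mat (fqsw_kraus E D) \<phi> *v \<psi>))\<^sup>2)"
    by (simp add: cdot_ketbra cdot_self \<phi> norm_square_sum overlap_mat_vec)
  finally have "1 - (norm (overlap_mat (fqsw_kraus E D) \<phi> *v \<psi>))\<^sup>2 \<le> \<epsilon>"
    using order_trans[OF trace_norm_ge[OF contraction_ketbra[of \<phi>]] close] \<phi> by simp
  then have "1 - \<epsilon> \<le> (norm (overlap_mat (fqsw_kraus E D) (target_vec \<psi>) *v \<psi>))\<^sup>2"
    by (simp add: \<phi>_def)
  with E(1) D(1) show ?thesis by (rule that)
qed

text \<open>The common core of both results: v is psi itself for the gain and a purification from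
  the smoothing ball for the cost. The witnesses are the AR-marginal of t and the state psi^R; only
  \<kappa> differs.\<close>

lemma hmin_cond_smooth_overlap_bound:
  fixes E :: "'k::finite \<Rightarrow> complex ^ 'a::finite ^ ('a1::finite \<times> 'a2::finite)"
    and D :: "'l::finite \<Rightarrow> complex ^ ('a2 \<times> 'b::finite) ^ ('a1 \<times> 'a \<times> 'b)"
    and \<psi> v :: "complex ^ ('a \<times> 'b \<times> 'r::finite)"
  defines "W \<equiv> overlap_mat (fqsw_kraus E D) (target_vec \<psi>)"
  assumes E: "kraus_family E" and D: "kraus_family D" and \<psi>: "norm \<psi> = 1"
    and good: "1 - \<epsilon> \<le> (norm (W *v \<psi>))\<^sup>2"
    and v: "norm v \<le> 1" "norm (v - \<psi>) \<le> 2 * \<epsilon>"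
    and \<epsilon>: "3 * \<epsilon> \<le> 1" "6 * \<epsilon> \<le> \<delta>\<^sup>2"
    and gram: "\<And>\<zeta>. (\<Sum>l\<in>UNIV. (cmod (\<Sum>k\<in>UNIV. cnj ((W *v v) $ (k, l)) * \<zeta> k))\<^sup>2) \<le>
      \<kappa> * (\<Sum>k\<in>UNIV. (cmod (\<zeta> k))\<^sup>2)"
  shows "- elog2 (\<kappa> * real CARD('a2) / real CARD('a1)) \<le> hmin_cond_smooth \<delta> (reduced_AR \<psi>)"
proof (rule hmin_cond_smooth_ge)
  define t where "t = adj W *v (W *v v)"
  have W: "contraction W"
    unfolding W_def by (intro contraction_overlap_mat kraus_family_fqsw_kraus E D)
      (simp add: norm_target_vec \<psi>)
  have W_le: "norm (W *v u) \<le> norm u" "norm (adj W *v u') \<le> norm u'" for u u'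
    using W contraction_adj[OF W] by (auto simp: contraction_def)
  have t1: "norm t \<le> 1"
    unfolding t_def using W_le(2)[of "W *v v"] W_le(1)[of v] v(1) by linarith
  show "rmat \<psi> ** adj (rmat \<psi>) \<in> states"
    by (simp add: states_def psd_gram trace_rmat cdot_self \<psi>)
  show "psd ((\<kappa> * real CARD('a2) / real CARD('a1)) *\<^sub>R tensor (mat 1) (rmat \<psi> ** adj (rmat \<psi>)) - reduced_AR t)"
    unfolding t_def W_def by (rule reduced_AR_overlap_bound[OF E D gram[unfolded W_def]])
  \<comment> \<open>The overlap of W v with W psi is |W psi|^2, up to 2 \<epsilon> for the shift
    from psi to v, since W is a contraction.\<close>
  have "1 - 3 * \<epsilon> \<le> Re (cdot t \<psi>)"
  proof -
    have "Re (cdot t \<psi>) = inner (W *v v) (W *v \<psi>)"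
      by (simp add: t_def inner_eq_cdot cdot_adj)
    also have "\<dots> = inner (W *v (v - \<psi>)) (W *v \<psi>) + (norm (W *v \<psi>))\<^sup>2"
      by (simp add: matrix_vector_mult_diff_distrib inner_diff_left flip: dot_square_norm)
    finally have "Re (cdot t \<psi>) = inner (W *v (v - \<psi>)) (W *v \<psi>) + (norm (W *v \<psi>))\<^sup>2" .
    moreover have "\<bar>inner (W *v (v - \<psi>)) (W *v \<psi>)\<bar> \<le> norm (W *v (v - \<psi>)) * norm (W *v \<psi>)"
      by (rule Cauchy_Schwarz_ineq2)
    moreover have "norm (W *v (v - \<psi>)) * norm (W *v \<psi>) \<le> (2 * \<epsilon>) * 1"
      using order_trans[OF W_le(1) v(2)] order_trans[OF norm_ge_zero v(2)] W_le(1)[of \<psi>] \<psi>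
      by (intro mult_mono) simp_all
    ultimately show ?thesis using good by linarith
  qed
  also have "Re (cdot t \<psi>) \<le> fidelity (reduced_AR t) (reduced_AR \<psi>)"
    using fidelity_gram_ge[of "armat t" "armat \<psi>"] by (simp add: trace_armat reduced_AR_gram)
  finally have f: "1 - 3 * \<epsilon> \<le> fidelity (reduced_AR t) (reduced_AR \<psi>)" .
  have "1 - \<delta>\<^sup>2 \<le> (1 - 3 * \<epsilon>)\<^sup>2"
  proof -
    have "(1 - 3 * \<epsilon>)\<^sup>2 = 1 - 6 * \<epsilon> + 9 * \<epsilon>\<^sup>2"
      by (simp add: power2_eq_square algebra_simps)
    then show ?thesis
      using \<epsilon>(2) zero_le_power2[of \<epsilon>] by linarith
  qed
  also have "\<dots> \<le> (fidelity (reduced_AR t) (reduced_AR \<psi>))\<^sup>2"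
    using f \<epsilon>(1) by (intro power_mono) auto
  finally show "reduced_AR t \<in> smoothing_ball \<delta> (reduced_AR \<psi>)"
    using t1 by (simp add: smoothing_ball_def substates_def reduced_AR_gram psd_gram
        trace_mult_commute[of "armat t"] trace_armat cdot_self power_le_one)
qed

text \<open>Uhlmann yields a vector v whose overlap with psi is the fidelity and whose A-marginal is
  dominated by \<rho>, hence by t I. The last conclusion keeps t away from 0, which later bounds the
  smooth entropy of A from above.\<close>

lemma smoothing_ball_purification:
  fixes \<psi> :: "complex ^ ('a::finite \<times> 'b::finite \<times> 'r::finite)"
  assumes \<psi>: "norm \<psi> = 1" and \<epsilon>: "0 \<le> \<epsilon>" "\<epsilon> \<le> 1"
    and \<rho>: "\<rho> \<in> smoothing_ball \<epsilon> (reduced_A \<psi>)" and t: "psd (t *\<^sub>R mat 1 - \<rho>)"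
  obtains v :: "complex ^ ('a \<times> 'b \<times> 'r)"
  where "norm v \<le> 1" "norm (v - \<psi>) \<le> 2 * \<epsilon>"
    "\<And>h. (norm (adj (amat v) *v h))\<^sup>2 \<le> t * (norm h)\<^sup>2"
    "1 - \<epsilon>\<^sup>2 \<le> t * real CARD('a)"
proof -
  have psd: "psd \<rho>" and tr: "Re (trace \<rho>) \<le> 1"
    and F: "1 - \<epsilon>\<^sup>2 \<le> (fidelity \<rho> (reduced_A \<psi>))\<^sup>2"
    using \<rho> by (auto simp: smoothing_ball_def substates_def)
  obtain Z :: "complex ^ ('b \<times> 'r) ^ 'a" where
    Z: "\<And>h. (norm (adj Z *v h))\<^sup>2 \<le> Re (cdot h (\<rho> *v h))"
    and ZF: "Re (trace (adj Z ** amat \<psi>)) = fidelity \<rho> (reduced_A \<psi>)"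
    using fidelity_gram_attained[OF psd, of "amat \<psi>"] unfolding reduced_A_gram by metis
  define v :: "complex ^ ('a \<times> 'b \<times> 'r)" where "v = (\<chi> x. Z $ fst x $ snd x)"
  have vZ: "amat v = Z"
    by (simp add: v_def amat_def vec_eq_iff)
  have marg: "(norm (adj (amat v) *v h))\<^sup>2 \<le> t * (norm h)\<^sup>2" for h
  proof -
    have "(t *\<^sub>R mat 1) *v h = of_real t *s h"
      by (simp add: vec_eq_iff matrix_vector_mult_def mat_def mult_delta_left
          scaleR_conv_of_real[where 'a = complex] if_distrib[of "\<lambda>u. _ * u"] if_distrib[of "\<lambda>u. u * _"] cong: if_cong)
    then have "0 \<le> t * (norm h)\<^sup>2 - Re (cdot h (\<rho> *v h))"
      using psd_Re[OF t, of h]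
      by (simp add: matrix_vector_mult_diff_rdistrib cdot_diff_right cdot_scale_right cdot_self
          del: of_real_power flip: of_real_mult)
    with Z[of h] show ?thesis by (simp add: vZ)
  qed
  have nv: "(norm v)\<^sup>2 = (\<Sum>a\<in>UNIV. (norm (adj Z *v axis a 1))\<^sup>2)"
    unfolding norm_square_sum sum_UNIV_prod[where 'a = 'a] by (simp add: mult_axis) (simp add: v_def adj_def)
  have "(norm v)\<^sup>2 \<le> (\<Sum>a\<in>UNIV. Re (cdot (axis a 1) (\<rho> *v axis a 1)))"
    unfolding nv by (intro sum_mono Z)
  also have "\<dots> = Re (trace \<rho>)"
    by (simp add: cdot_axis mult_axis trace_def)
  also have "\<dots> \<le> 1\<^sup>2"
    using tr by simp
  finally have v1: "norm v \<le> 1"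
    by (rule power2_le_imp_le) simp
  have vt: "(norm v)\<^sup>2 \<le> t * real CARD('a)"
  proof -
    have "(norm v)\<^sup>2 \<le> (\<Sum>a\<in>(UNIV :: 'a set). t * (norm (axis a (1::complex)))\<^sup>2)"
      unfolding nv by (intro sum_mono marg[unfolded vZ])
    then show ?thesis by (simp add: norm_axis_1 mult.commute)
  qed
  define f where "f = Re (cdot v \<psi>)"
  have "f = fidelity \<rho> (reduced_A \<psi>)"
    using ZF by (simp add: f_def trace_amat flip: vZ)
  then have f: "0 \<le> f" "1 - \<epsilon>\<^sup>2 \<le> f\<^sup>2"
    using F by (simp_all add: fidelity_def trace_norm_nonneg)
  have fv: "f \<le> norm v"
    unfolding f_def using norm_cauchy_schwarz[of v \<psi>] by (simp add: inner_eq_cdot \<psi>)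
  \<comment> \<open>As 0 \<le> f \<le> 1, the bound on the squared fidelity also holds for f, so |v
    - psi|^2 is at most 2 - 2 (1 - \<epsilon>^2), which is below (2 \<epsilon>)^2.\<close>
  then have "f\<^sup>2 \<le> f"
    using f(1) v1 by (simp add: power2_eq_square mult_left_le)
  then have f1: "1 - \<epsilon>\<^sup>2 \<le> f" using f(2) by linarith
  have "(norm (v - \<psi>))\<^sup>2 = (norm v)\<^sup>2 + 1 - 2 * f"
    unfolding f_def inner_eq_cdot[symmetric] dot_square_norm[symmetric]
    by (simp add: inner_diff_left inner_diff_right inner_commute dot_square_norm[of \<psi>] \<psi>)
  also have "\<dots> \<le> (2 * \<epsilon>)\<^sup>2"
  proof -
    have "(2 * \<epsilon>)\<^sup>2 = 4 * \<epsilon>\<^sup>2" by (simp add: power_mult_distrib)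
    then show ?thesis
      using f1 power_le_one[OF norm_ge_zero v1, of 2] zero_le_power2[of \<epsilon>] by linarith
  qed
  finally have "norm (v - \<psi>) \<le> 2 * \<epsilon>"
    by (rule power2_le_imp_le) (use \<epsilon> in simp)
  moreover have "1 - \<epsilon>\<^sup>2 \<le> t * real CARD('a)"
    using f(2) power_mono[OF fv f(1), of 2] vt by linarith
  ultimately show ?thesis
    using that[OF v1 _ marg] by blast
qed

(* The case distinctions state the convention that the bounds are vacuous for \<delta> \<ge> 1.  In the
   lower bound it matters: for \<epsilon> = 1 both entropies are infinite, and the library's difference
   of the two would be \<infinity>. *)
theorem theorem9:
  fixes \<psi> :: "complex ^ ('a::finite \<times> 'b::finite \<times> 'r::finite)"
    and enc :: "'a op \<Rightarrow> ('a1::finite \<times> 'a2::finite) op"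
    and dec :: "('a2 \<times> 'b) op \<Rightarrow> ('a1 \<times> 'a \<times> 'b) op"
    and \<epsilon> \<delta> :: real
  assumes "0 < \<epsilon>" and "\<epsilon> \<le> 1"
    and "norm \<psi> = 1"
    and "fqsw_protocol \<epsilon> \<psi> enc dec"
    and "\<delta> = 3 * (\<epsilon> + sqrt (3 * sqrt \<epsilon>))"
  shows "ereal (communication_cost enc) \<ge>
           (if \<delta> \<ge> 1 then -\<infinity>
            else ereal (1 / 2)
                   * (hmin_smooth \<epsilon> (reduced_A \<psi>) - hmin_cond_smooth \<delta> (reduced_AR \<psi>))
                 - ereal (log 2 (sqrt 2 / \<epsilon>))) \<and>
         ereal (entanglement_gain enc) \<le>
           (if \<delta> \<ge> 1 then \<infinity>
            else ereal (communication_cost enc) + hmin_cond_smooth \<delta> (reduced_AR \<psi>)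
                 + ereal (log 2 (2 / \<epsilon>\<^sup>2)))"
proof (cases "\<delta> \<ge> 1")
  case True
  then show ?thesis by simp
next
  case False
  define H where "H = hmin_cond_smooth \<delta> (reduced_AR \<psi>)"
  define d1 where "d1 = real CARD('a1)"
  define d2 where "d2 = real CARD('a2)"
  have d: "d1 > 0" "d2 > 0" by (simp_all add: d1_def d2_def)
  have \<epsilon>3: "3 * \<epsilon> \<le> 1"
  proof -
    define s where "s = sqrt (3 * sqrt \<epsilon>)"
    have "0 \<le> s" using assms(1) by (simp add: s_def)
    moreover have "\<delta> = 3 * \<epsilon> + 3 * s" using assms(5) by (simp add: s_def)
    ultimately show ?thesis using False by linarith
  qed
  \<comment> \<open>The nested root is what counts: its part of \<delta> has square 27 sqrt
    \<epsilon>, and \<epsilon> \<le> sqrt \<epsilon>.\<close>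
  have \<delta>: "6 * \<epsilon> \<le> \<delta>\<^sup>2"
  proof -
    have "(3 * sqrt (3 * sqrt \<epsilon>))\<^sup>2 \<le> \<delta>\<^sup>2"
      using assms(1,5) by (intro power_mono) auto
    then have "27 * sqrt \<epsilon> \<le> \<delta>\<^sup>2"
      using assms(1) by (simp add: power_mult_distrib)
    moreover have "\<epsilon> \<le> sqrt \<epsilon>"
      using assms(1,2) by (intro real_le_rsqrt) (simp add: power2_eq_square mult_left_le)
    ultimately show ?thesis using assms(1) by linarith
  qed
  obtain E :: "'a \<times> ('a1 \<times> 'a2) \<Rightarrow> complex ^ 'a ^ ('a1 \<times> 'a2)"
    and D :: "('a2 \<times> 'b) \<times> ('a1 \<times> 'a \<times> 'b) \<Rightarrow> complex ^ ('a2 \<times> 'b) ^ ('a1 \<times> 'a \<times> 'b)"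
    where K: "kraus_family E" "kraus_family D"
      "1 - \<epsilon> \<le> (norm (overlap_mat (fqsw_kraus E D) (target_vec \<psi>) *v \<psi>))\<^sup>2"
    using fqsw_protocol_kraus[OF assms(3,4)] by blast
  let ?W = "overlap_mat (fqsw_kraus E D) (target_vec \<psi>)"
  have "contraction ?W"
    by (intro contraction_overlap_mat kraus_family_fqsw_kraus K) (simp add: norm_target_vec assms(3))
  then have "norm (?W *v \<psi>) \<le> 1"
    using assms(3) by (metis contraction_def)
  note gram = overlap_gram_bound_norm[OF this]
  have "norm \<psi> \<le> 1" "norm (\<psi> - \<psi>) \<le> 2 * \<epsilon>"
    using assms(1,3) by simp_all
  \<comment> \<open>The instance v = psi with \<kappa> = 1.\<close>
  from hmin_cond_smooth_overlap_bound[OF K(1,2) assms(3) K(3) this \<epsilon>3 \<delta>, of 1]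
  have "- elog2 (d2 / d1) \<le> H"
    unfolding H_def d1_def d2_def mult_1 using gram by blast
  then have gain: "ereal (log 2 d1 - log 2 d2) \<le> H"
    using d by (simp add: elog2_def log_divide divide_le_0_iff)
  \<comment> \<open>The first bound, taken over all \<rho> and t, yields the communication cost. The
    second does not depend on \<rho> or t and serves only to show that the smooth entropy of A is
    not infinite.\<close>
  have min_bound: "- elog2 t \<le> H + ereal (2 * log 2 d2) \<and> - elog2 t \<le> ereal (- log 2 ((1 - \<epsilon>\<^sup>2) / real CARD('a)))"
    if \<rho>: "\<rho> \<in> smoothing_ball \<epsilon> (reduced_A \<psi>)" and t: "psd (t *\<^sub>R mat 1 - \<rho>)" for \<rho> t
  proof -
    obtain v :: "complex ^ ('a \<times> 'b \<times> 'r)"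
      where v: "norm v \<le> 1" "norm (v - \<psi>) \<le> 2 * \<epsilon>"
        and marg: "\<And>h. (norm (adj (amat v) *v h))\<^sup>2 \<le> t * (norm h)\<^sup>2"
        and tA: "1 - \<epsilon>\<^sup>2 \<le> t * real CARD('a)"
      using smoothing_ball_purification[OF assms(3) less_imp_le[OF assms(1)] assms(2) \<rho> t] by blast
    have "\<epsilon>\<^sup>2 < 1"
      using assms(1) \<epsilon>3 by (intro power_less_one_iff[THEN iffD2]) auto
    then have t_ge: "(1 - \<epsilon>\<^sup>2) / real CARD('a) \<le> t" and pos: "(1 - \<epsilon>\<^sup>2) / real CARD('a) > 0"
      using tA by (simp_all add: field_simps)
    then have "t > 0" by linarith
    have "norm \<psi> \<le> 1" using assms(3) by simp
    note gram = overlap_gram_bound_marginal[OF K(1,2) this marg]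
    \<comment> \<open>Here \<kappa> is t |A1||A2|, and |A1| cancels against the Bell
      normalization.\<close>
    have "- elog2 (t * (real CARD('a1) * real CARD('a2)) * real CARD('a2) / real CARD('a1)) \<le> H"
      unfolding H_def
      by (intro hmin_cond_smooth_overlap_bound[OF K(1,2) assms(3) K(3) v \<epsilon>3 \<delta>] gram)
    also have "t * (real CARD('a1) * real CARD('a2)) * real CARD('a2) / real CARD('a1) = t * d2\<^sup>2"
      by (simp add: d2_def power2_eq_square)
    also have "- elog2 (t * d2\<^sup>2) = ereal (- log 2 t - 2 * log 2 d2)"
    proof -
      have "t * d2\<^sup>2 > 0" using d \<open>t > 0\<close> by simp
      moreover have "log 2 (t * d2\<^sup>2) = log 2 t + 2 * log 2 d2"
        using d \<open>t > 0\<close> by (simp add: log_mult log_nat_power)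
      ultimately show ?thesis by (simp add: elog2_def)
    qed
    finally have "ereal (- log 2 t - 2 * log 2 d2) \<le> H" .
    then have "- elog2 t \<le> H + ereal (2 * log 2 d2)"
      using \<open>t > 0\<close> by (cases H) (simp_all add: elog2_def)
    moreover have "log 2 ((1 - \<epsilon>\<^sup>2) / real CARD('a)) \<le> log 2 t"
      using t_ge pos by simp
    ultimately show ?thesis
      using \<open>t > 0\<close> by (simp add: elog2_def)
  qed
  have cost: "hmin_smooth \<epsilon> (reduced_A \<psi>) \<le> H + ereal (2 * log 2 d2)"
    using min_bound by (intro hmin_smooth_le) blast
  have "hmin_smooth \<epsilon> (reduced_A \<psi>) \<le> ereal (- log 2 ((1 - \<epsilon>\<^sup>2) / real CARD('a)))"
    using min_bound by (intro hmin_smooth_le) blast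
  \<comment> \<open>No upper bound on H is at hand; this keeps the difference of the two entropies
    from being \<infinity> - \<infinity>.\<close>
  then have fin: "hmin_smooth \<epsilon> (reduced_A \<psi>) \<noteq> \<infinity>"
    by auto
  have slack: "0 \<le> log 2 (2 / \<epsilon>\<^sup>2)" "0 \<le> log 2 (sqrt 2 / \<epsilon>)"
  proof -
    have "\<epsilon>\<^sup>2 \<le> 2" "\<epsilon> \<le> sqrt 2"
      using assms(1,2) power_le_one[of \<epsilon> 2] real_le_rsqrt[of \<epsilon> 2] by auto
    then show "0 \<le> log 2 (2 / \<epsilon>\<^sup>2)" "0 \<le> log 2 (sqrt 2 / \<epsilon>)"
      using assms(1) by (simp_all add: zero_le_log_cancel_iff)
  qed
  \<comment> \<open>Halving \<open>cost\<close>; the case H = -\<infinity> is excluded by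
    \<open>gain\<close>, and the nonnegative c only lowers the left side.\<close>
  have "ereal (1 / 2) * (hmin_smooth \<epsilon> (reduced_A \<psi>) - H) - ereal c \<le> ereal (log 2 d2)"
    if "0 \<le> c" for c
    using cost fin gain that
    by (cases H; cases "hmin_smooth \<epsilon> (reduced_A \<psi>)") (auto simp: field_simps)
  note this[OF slack(2)]
  moreover have "ereal (log 2 d1) \<le> ereal (log 2 d2) + H + ereal (log 2 (2 / \<epsilon>\<^sup>2))"
    using gain slack(1) by (cases H) auto
  ultimately show ?thesis
    using False by (simp add: communication_cost_def entanglement_gain_def H_def d1_def d2_def)
qed

end
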